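(* For each $N\in[1,\infty)$ there exists a constant $C'_N>0$ such that the inequality $$\lambda_1^{\mathrm{Gro}}(G,X)\geq C'_N\,\mu_1(G)$$ holds for every uniformly locally doubling complete $\mathrm{CAT}(0)$ space $X$ with doubling constant $N$ and every graph $G$.
   Context: Standing assumptions: every graph $G=(V,E)$ is simple, connected, and satisfies $2\le|V|<\infty$; every metric space contains at least two points. Weights: let $\vec E=\{(u,v)\in V\times V: \{u,v\}\in E\}$. Graphs carry the uniform weight $m(u,v)=1$ if $(u,v)\in\vec E$ and $m(u,v)=0$ otherwise; $m(u)=\sum_{v\in V}m(u,v)$ and $m(V)=\sum_{v\in V}m(v)$. Linear spectral gap: $\mu_1(G)$ is the first positive eigenvalue of the combinatorial Laplacian $\Delta f(v)=f(v)-\sum_{u\in V}\frac{m(v,u)}{m(v)}f(u)$ acting on functions $f:V\to\mathbb{R}$. Gromov nonlinear spectral gap: for a metric space $(X,d_X)$, $$\lambda_1^{\mathrm{Gro}}(G,X)=\inf\left\{\frac{\sum_{u,v\in V}m(u,v)d_X(f(u),f(v))^2}{\frac{1}{m(V)}\sum_{u,v\in V}m(u)m(v)d_X(f(u),f(v))^2}\ \Big|\ f:V\to X\text{ nonconstant}\right\}.$$ Doubling: a metric space is doubling with doubling constant $N\in[1,\infty)$ if every closed ball can be covered by at most $N$ closed balls of half the radius. A metric space is uniformly locally doubling with doubling constant $N$ if any point has a neighborhood which is doubling with doubling constant $N$. *)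

theory Defs
  imports "HOL-Analysis.Analysis" "Graph_Theory.Digraph_Component"
begin

section \<open>Finite graphs, uniform weights and the linear spectral gap\<close>

text \<open>
  A simple graph is represented by its vertex set \<open>pverts G\<close> together with the set \<open>parcs G\<close> of
  its oriented edges: a \<open>pair_graph\<close> is finite, loop-free, has no parallel arcs, and its arc
  set is a symmetric relation on \<open>pverts G\<close>.
\<close>

definition std_graph :: "'v pair_pre_digraph \<Rightarrow> bool" where
  "std_graph G \<longleftrightarrow>
     pair_graph G \<and> Digraph_Component.connected (with_proj G) \<and> 2 \<le> card (pverts G)"

definition edge_weight :: "'v pair_pre_digraph \<Rightarrow> 'v \<Rightarrow> 'v \<Rightarrow> real" where
  "edge_weight G u v = (if (u, v) \<in> parcs G then 1 else 0)"

definition vertex_weight :: "'v pair_pre_digraph \<Rightarrow> 'v \<Rightarrow> real" where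
  "vertex_weight G u = (\<Sum>v\<in>pverts G. edge_weight G u v)"

definition total_weight :: "'v pair_pre_digraph \<Rightarrow> real" where
  "total_weight G = (\<Sum>v\<in>pverts G. vertex_weight G v)"

text \<open>Functions on the vertex set are total functions of which only the values on \<open>pverts G\<close> matter.\<close>

definition laplacian :: "'v pair_pre_digraph \<Rightarrow> ('v \<Rightarrow> real) \<Rightarrow> 'v \<Rightarrow> real" where
  "laplacian G f v = f v - (\<Sum>u\<in>pverts G. edge_weight G v u / vertex_weight G v * f u)"

definition laplacian_eigenvalue :: "'v pair_pre_digraph \<Rightarrow> real \<Rightarrow> bool" where
  "laplacian_eigenvalue G \<mu> \<longleftrightarrow>
     (\<exists>f. (\<exists>v\<in>pverts G. f v \<noteq> 0) \<and> (\<forall>v\<in>pverts G. laplacian G f v = \<mu> * f v))"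

definition linear_gap :: "'v pair_pre_digraph \<Rightarrow> real" where
  "linear_gap G = (LEAST \<mu>. 0 < \<mu> \<and> laplacian_eigenvalue G \<mu>)"


section \<open>The Gromov nonlinear spectral gap\<close>

definition gromov_quotient :: "'v pair_pre_digraph \<Rightarrow> 'a metric \<Rightarrow> ('v \<Rightarrow> 'a) \<Rightarrow> real" where
  "gromov_quotient G X f =
     (\<Sum>u\<in>pverts G. \<Sum>v\<in>pverts G. edge_weight G u v * (mdist X (f u) (f v))\<^sup>2) /
     (1 / total_weight G *
       (\<Sum>u\<in>pverts G. \<Sum>v\<in>pverts G.
          vertex_weight G u * vertex_weight G v * (mdist X (f u) (f v))\<^sup>2))"

definition gromov_gap :: "'v pair_pre_digraph \<Rightarrow> 'a metric \<Rightarrow> real" where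
  "gromov_gap G X =
     Inf {gromov_quotient G X f | f.
            f \<in> pverts G \<rightarrow> mspace X \<and> (\<exists>u\<in>pverts G. \<exists>v\<in>pverts G. f u \<noteq> f v)}"


section \<open>CAT(0) spaces\<close>

definition geodesic_path :: "'a metric \<Rightarrow> (real \<Rightarrow> 'a) \<Rightarrow> 'a \<Rightarrow> 'a \<Rightarrow> bool" where
  "geodesic_path X c x y \<longleftrightarrow>
     c \<in> {0..mdist X x y} \<rightarrow> mspace X \<and> c 0 = x \<and> c (mdist X x y) = y \<and>
     (\<forall>s\<in>{0..mdist X x y}. \<forall>t\<in>{0..mdist X x y}. mdist X (c s) (c t) = \<bar>s - t\<bar>)"

definition geodesic_segment :: "'a metric \<Rightarrow> 'a \<Rightarrow> 'a \<Rightarrow> 'a set \<Rightarrow> bool" where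
  "geodesic_segment X x y S \<longleftrightarrow> (\<exists>c. geodesic_path X c x y \<and> S = c ` {0..mdist X x y})"

definition geodesic_space :: "'a metric \<Rightarrow> bool" where
  "geodesic_space X \<longleftrightarrow> (\<forall>x\<in>mspace X. \<forall>y\<in>mspace X. \<exists>S. geodesic_segment X x y S)"

definition comparison_point ::
  "'a metric \<Rightarrow> 'a \<Rightarrow> 'a set \<Rightarrow> real^2 \<Rightarrow> real^2 \<Rightarrow> 'a \<Rightarrow> real^2 \<Rightarrow> bool" where
  "comparison_point X x S x' y' p p' \<longleftrightarrow>
     p \<in> S \<and> p' \<in> closed_segment x' y' \<and> dist x' p' = mdist X x p"

text \<open>
  Every geodesic triangle (vertices \<open>x\<close>, \<open>y\<close>, \<open>z\<close>; sides \<open>A = [x,y]\<close>, \<open>B = [y,z]\<close>, \<open>C = [z,x]\<close>)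
  is at least as thin as its comparison triangle in the Euclidean plane. A point lying on two
  sides has a comparison point on each of the corresponding sides.
\<close>

definition CAT0 :: "'a metric \<Rightarrow> bool" where
  "CAT0 X \<longleftrightarrow> geodesic_space X \<and>
     (\<forall>x\<in>mspace X. \<forall>y\<in>mspace X. \<forall>z\<in>mspace X. \<forall>A B C. \<forall>x' y' z' :: real^2.
        geodesic_segment X x y A \<and> geodesic_segment X y z B \<and> geodesic_segment X z x C \<and>
        dist x' y' = mdist X x y \<and> dist y' z' = mdist X y z \<and> dist z' x' = mdist X z x \<longrightarrow>
        (let comp = (\<lambda>p p'. comparison_point X x A x' y' p p' \<or>
                            comparison_point X y B y' z' p p' \<or>
                            comparison_point X z C z' x' p p')
         in \<forall>p p' q q'. comp p p' \<and> comp q q' \<longrightarrow> mdist X p q \<le> dist p' q'))"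


section \<open>Doubling spaces\<close>

definition doubling :: "real \<Rightarrow> 'a metric \<Rightarrow> bool" where
  "doubling N X \<longleftrightarrow>
     (\<forall>x\<in>mspace X. \<forall>r>0. \<exists>Z. finite Z \<and> real (card Z) \<le> N \<and> Z \<subseteq> mspace X \<and>
        mcball_of X x r \<subseteq> (\<Union>z\<in>Z. mcball_of X z (r / 2)))"

text \<open>A neighborhood carries the restricted metric, so its balls are centered in and contained in it.\<close>

definition uniformly_locally_doubling :: "real \<Rightarrow> 'a metric \<Rightarrow> bool" where
  "uniformly_locally_doubling N X \<longleftrightarrow>
     (\<forall>x\<in>mspace X. \<exists>U W. openin (mtopology_of X) W \<and> x \<in> W \<and> W \<subseteq> U \<and> U \<subseteq> mspace X \<and>
        doubling N (submetric X U))"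


section \<open>Admissible constants\<close>

text \<open>
  \<open>C\<close> is admissible for \<open>N\<close> if the inequality between the two gaps holds for all graphs with
  vertices in \<open>'v\<close> and all spaces with points in \<open>'a\<close>. The type arguments only make explicit
  which carrier types are quantified over; metric spaces are required to have two points.
\<close>

definition gap_constant :: "'v itself \<Rightarrow> 'a itself \<Rightarrow> real \<Rightarrow> real \<Rightarrow> bool" where
  "gap_constant _ _ N C \<longleftrightarrow>
     (\<forall>(X :: 'a metric) (G :: 'v pair_pre_digraph).
        (\<exists>x\<in>mspace X. \<exists>y\<in>mspace X. x \<noteq> y) \<and> mcomplete_of X \<and> CAT0 X \<and>
        uniformly_locally_doubling N X \<and> std_graph G \<longrightarrow>
        gromov_gap G X \<ge> C * linear_gap G)"

text \<open>
  HOL cannot quantify over types below \<open>\<exists>C\<close>, so a bare \<open>\<exists>C>0. gap_constant TYPE('v) TYPE('a) N C\<close>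
  would let the constant depend on the carrier types. To express one constant for all spaces and
  graphs whatever their carriers, \<open>C\<close> is obtained for graphs on \<open>nat\<close> and spaces in \<open>real\<close>, and the
  same \<open>C\<close> is asserted to serve every other pair of types. (A connected locally doubling space is
  separable, hence isometric to a metric on a set of reals, so this is no stronger than the
  uniform claim.)
\<close>

end

theory Submission
  imports Defs
begin

text \<open>
  Let \<open>f : V \<rightarrow> X\<close> be nonconstant and let \<open>p\<close> be the barycenter of \<open>f\<close>, the point minimizing the
  weighted sum \<open>S\<close> of the squared distances to the points \<open>f v\<close>. The triangle inequality bounds the
  denominator of the Gromov quotient by \<open>4 S\<close>, so it suffices to bound the energy
  \<open>E = \<Sum> m(u,v) d(f u, f v)\<^sup>2\<close> from below by a multiple of \<open>\<mu>\<^sub>1 S\<close> depending on \<open>N\<close> only.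

  Scaling. Contracting \<open>f\<close> towards \<open>p\<close> along geodesics by a factor \<open>t\<close> multiplies \<open>S\<close> by \<open>t\<^sup>2\<close> and, by the
  CAT(0) inequality, \<open>E\<close> by at most \<open>t\<^sup>2\<close> (\<open>CAT0_contraction\<close>). The point \<open>p\<close> remains a barycenter
  (\<open>contracted_map_barycenter\<close>). Taking \<open>t\<close> small places the whole image in a doubling neighborhood
  of \<open>p\<close>.

  Concentration. Every 1-Lipschitz function on \<open>X\<close> has, along \<open>f\<close>, variance at most of order
  \<open>E / \<mu>\<^sub>1\<close>, by the linear Poincare inequality (\<open>linear_gap_poincare\<close>). Applied to the distance from
  \<open>p\<close> this says that \<open>S\<close> is essentially \<open>R\<^sup>2\<close> times the total weight, with \<open>R\<close> the mean distance to \<open>p\<close>. By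
  Markov's inequality half of the weight lies in the ball of radius \<open>2 R\<close>, and doubling covers that
  ball by \<open>N\<^sup>2\<close> balls of radius \<open>R / 2\<close>, so that one of them carries a definite part of the weight. If \<open>E\<close>
  were much smaller than \<open>\<mu>\<^sub>1 S\<close>, the distance from the center \<open>z\<close> of that ball would be nearly constant,
  hence almost everything would lie within about \<open>R / 2\<close> of \<open>z\<close>, and \<open>z\<close> would be a better
  barycenter than \<open>p\<close> (\<open>barycenter_concentration\<close>).

  A constant valid for vertices in \<open>nat\<close> and points in \<open>real\<close> is valid for all carriers: a finite
  vertex set can be relabelled by natural numbers, and a uniformly locally doubling geodesic space
  has at most the cardinality of the continuum, so that it is isometric to a space carried by a set
  of reals (\<open>uniformly_locally_doubling_lepoll_reals\<close>).
\<close>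

section \<open>The Poincare inequality of a finite graph\<close>

text \<open>
  The walk-based connectedness of the graph library is reduced to the reflexive transitive closure
  of the arc relation, which is easy to induct on and to transport along relabellings.
\<close>

lemma std_graph_iff:
  "std_graph G \<longleftrightarrow> finite (pverts G) \<and> 2 \<le> card (pverts G) \<and> parcs G \<subseteq> pverts G \<times> pverts G \<and>
     sym (parcs G) \<and> irrefl (parcs G) \<and> (\<forall>u\<in>pverts G. \<forall>v\<in>pverts G. (u, v) \<in> (parcs G)\<^sup>*)"
  (is "?L \<longleftrightarrow> ?R")
proof -
  have reach: "(u, v) \<in> rtrancl_on (pverts G) ((parcs G)\<^sup>s) \<longleftrightarrow> (u, v) \<in> (parcs G)\<^sup>*"
    if wf: "parcs G \<subseteq> pverts G \<times> pverts G" and s: "sym (parcs G)" and u: "u \<in> pverts G" for u v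
  proof
    have sc: "(parcs G)\<^sup>s = parcs G"
      using s by (auto simp: symcl_def sym_def)
    show "(u, v) \<in> (parcs G)\<^sup>*" if "(u, v) \<in> rtrancl_on (pverts G) ((parcs G)\<^sup>s)"
      using that unfolding sc by induct (auto intro: rtrancl_into_rtrancl)
    show "(u, v) \<in> rtrancl_on (pverts G) ((parcs G)\<^sup>s)" if "(u, v) \<in> (parcs G)\<^sup>*"
      using that
    proof (induct rule: rtrancl_induct)
      case base
      then show ?case using u by auto
    next
      case (step y z)
      then show ?case unfolding sc using wf by (auto intro: rtrancl_on_into_rtrancl_on)
    qed
  qed
  have pg: "pair_graph G \<longleftrightarrow> finite (pverts G) \<and> parcs G \<subseteq> pverts G \<times> pverts G \<and> sym (parcs G) \<and> irrefl (parcs G)"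
  proof
    assume "pair_graph G"
    then interpret pair_graph G .
    have "irrefl (parcs G)" using pair_no_loops by (force intro: irreflI)
    then show "finite (pverts G) \<and> parcs G \<subseteq> pverts G \<times> pverts G \<and> sym (parcs G) \<and> irrefl (parcs G)"
      using pair_finite_verts pair_sym_arcs in_arcsD1 in_arcsD2 by (auto simp: symmetric_def)
  next
    assume *: "finite (pverts G) \<and> parcs G \<subseteq> pverts G \<times> pverts G \<and> sym (parcs G) \<and> irrefl (parcs G)"
    then have "finite (parcs G)" using finite_subset by blast
    with * show "pair_graph G"
      by unfold_locales (auto simp: symmetric_def irrefl_def)
  qed
  show ?thesis
    unfolding std_graph_def pg connected_conv using reach by (auto simp: )
qed

text \<open>
  The sum runs over ordered pairs, so each edge counts twice and the form is
  twice the quadratic form of the Laplacian.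
\<close>

definition dirichlet_form :: "'v pair_pre_digraph \<Rightarrow> ('v \<Rightarrow> real) \<Rightarrow> ('v \<Rightarrow> real) \<Rightarrow> real" where
  "dirichlet_form G g h =
     (\<Sum>u\<in>pverts G. \<Sum>v\<in>pverts G. edge_weight G u v * ((g u - g v) * (h u - h v)))"

definition vertex_inner :: "'v pair_pre_digraph \<Rightarrow> ('v \<Rightarrow> real) \<Rightarrow> ('v \<Rightarrow> real) \<Rightarrow> real" where
  "vertex_inner G g h = (\<Sum>v\<in>pverts G. vertex_weight G v * (g v * h v))"

lemma dirichlet_form_simps:
  "dirichlet_form G (\<lambda>v. g v + h v) k = dirichlet_form G g k + dirichlet_form G h k"
  "dirichlet_form G k (\<lambda>v. g v + h v) = dirichlet_form G k g + dirichlet_form G k h"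
  "dirichlet_form G (\<lambda>v. c * g v) k = c * dirichlet_form G g k"
  "dirichlet_form G k (\<lambda>v. c * g v) = c * dirichlet_form G k g"
  "dirichlet_form G k (\<lambda>v. c) = 0"
  "dirichlet_form G (\<lambda>v. c) k = 0"
  by (simp_all add: dirichlet_form_def sum_distrib_left sum.distrib[symmetric] algebra_simps)

lemma dirichlet_form_commute: "dirichlet_form G g h = dirichlet_form G h g"
  by (simp add: dirichlet_form_def mult.commute)

lemma vertex_inner_simps:
  "vertex_inner G (\<lambda>v. g v + h v) k = vertex_inner G g k + vertex_inner G h k"
  "vertex_inner G k (\<lambda>v. g v + h v) = vertex_inner G k g + vertex_inner G k h"
  "vertex_inner G (\<lambda>v. c * g v) k = c * vertex_inner G g k"
  "vertex_inner G k (\<lambda>v. c * g v) = c * vertex_inner G k g"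
  by (simp_all add: vertex_inner_def sum_distrib_left sum.distrib[symmetric] algebra_simps)

lemma vertex_inner_commute: "vertex_inner G g h = vertex_inner G h g"
  by (simp add: vertex_inner_def mult.commute)

lemma edge_weight_nonneg: "0 \<le> edge_weight G u v"
  by (simp add: edge_weight_def)

lemma edge_weight_commute: "std_graph G \<Longrightarrow> edge_weight G u v = edge_weight G v u"
  by (auto simp: edge_weight_def std_graph_iff sym_def)

text \<open>
  By connectedness a vertex has an edge towards any other vertex of the graph. The lower bound 1,
  rather than mere positivity, confines \<open>vertex_inner\<close>-unit vectors to the cube \<open>[-1,1]\<close>.
\<close>

lemma vertex_weight_ge_1:
  assumes G: "std_graph G" and v: "v \<in> pverts G"
  shows "1 \<le> vertex_weight G v"
proof -
  have fin: "finite (pverts G)" using G by (simp add: std_graph_iff)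
  obtain u where u: "u \<in> pverts G" "u \<noteq> v"
    using G v by (metis One_nat_def Suc_1 card_le_Suc0_iff_eq std_graph_iff not_less_eq_eq)
  have "(v, u) \<in> (parcs G)\<^sup>*" using G u v by (simp add: std_graph_iff)
  then obtain x where x: "(v, x) \<in> parcs G" using u by (metis converse_rtranclE)
  then have xV: "x \<in> pverts G" using G by (auto simp: std_graph_iff)
  have "edge_weight G v x \<le> vertex_weight G v"
    unfolding vertex_weight_def
    by (rule member_le_sum[OF xV]) (use fin in \<open>auto simp: edge_weight_nonneg\<close>)
  then show ?thesis using x by (simp add: edge_weight_def)
qed

text \<open>
  Summation by parts: expanding \<open>h u - h v\<close> and exchanging the two vertices in the second half gives
  the same sum twice, as the edge weights are symmetric.
\<close>

lemma dirichlet_form_eq_laplacian: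
  assumes G: "std_graph G"
  shows "dirichlet_form G g h = 2 * vertex_inner G (laplacian G g) h"
proof -
  let ?V = "pverts G" and ?e = "edge_weight G"
  have "vertex_inner G (laplacian G g) h = (\<Sum>u\<in>?V. \<Sum>v\<in>?V. ?e u v * ((g u - g v) * h u))"
    unfolding vertex_inner_def
  proof (rule sum.cong[OF refl])
    fix u assume u: "u \<in> ?V"
    then have w: "vertex_weight G u \<noteq> 0" using vertex_weight_ge_1[OF G u] by simp
    have "vertex_weight G u * laplacian G g u = vertex_weight G u * g u - (\<Sum>v\<in>?V. ?e u v * g v)"
      using w by (simp add: laplacian_def right_diff_distrib sum_distrib_left)
    also have "\<dots> = (\<Sum>v\<in>?V. ?e u v * (g u - g v))"
      by (simp add: vertex_weight_def sum_distrib_right sum_subtractf right_diff_distrib)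
    finally show "vertex_weight G u * (laplacian G g u * h u) = (\<Sum>v\<in>?V. ?e u v * ((g u - g v) * h u))"
      by (simp add: sum_distrib_right flip: mult.assoc)
  qed
  then have "2 * vertex_inner G (laplacian G g) h = (\<Sum>u\<in>?V. \<Sum>v\<in>?V. ?e u v * ((g u - g v) * h u)) + (\<Sum>u\<in>?V. \<Sum>v\<in>?V. ?e v u * ((g v - g u) * h v))"
    using sum.swap[of "\<lambda>u v. ?e u v * ((g u - g v) * h u)" ?V ?V] by simp
  also have "\<dots> = dirichlet_form G g h"
    unfolding dirichlet_form_def sum.distrib[symmetric]
  proof (intro sum.cong refl)
    fix u v
    show "?e u v * ((g u - g v) * h u) + ?e v u * ((g v - g u) * h v) = ?e u v * ((g u - g v) * (h u - h v))"
      unfolding edge_weight_commute[OF G, of v u] by (simp add: algebra_simps)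
  qed
  finally show ?thesis by simp
qed

lemma linear_term_eq_0:
  fixes a b :: real
  assumes "\<And>t. 0 \<le> t * b + t\<^sup>2 * a"
  shows "b = 0"
proof (rule ccontr)
  assume b: "b \<noteq> 0"
  define k where "k = \<bar>a\<bar> + 1"
  have k: "k > 0" "a < k" by (auto simp: k_def)
  have "0 \<le> (- b / k) * b + (- b / k)\<^sup>2 * a" by (rule assms)
  also have "\<dots> = b\<^sup>2 * (a - k) / k\<^sup>2" using k by (simp add: field_simps power2_eq_square)
  also have "\<dots> < 0" using k b by (intro divide_neg_pos mult_pos_neg) auto
  finally show False by simp
qed

lemma dirichlet_form_eq_0_imp_constant:
  assumes G: "std_graph G" and g: "dirichlet_form G g g = 0"
    and u: "u \<in> pverts G" and v: "v \<in> pverts G"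
  shows "g u = g v"
proof -
  have fin: "finite (pverts G)" using G by (simp add: std_graph_iff)
  have "(\<Sum>v\<in>pverts G. edge_weight G u v * ((g u - g v) * (g u - g v))) = 0" if "u \<in> pverts G" for u
    using g fin that unfolding dirichlet_form_def
    by (subst (asm) sum_nonneg_eq_0_iff) (auto intro!: sum_nonneg simp: edge_weight_nonneg)
  then have edge: "edge_weight G u v * ((g u - g v) * (g u - g v)) = 0"
    if "u \<in> pverts G" "v \<in> pverts G" for u v
    using that fin by (subst (asm) sum_nonneg_eq_0_iff) (auto simp: edge_weight_nonneg)
  have step: "g x = g y" if "(x, y) \<in> parcs G" for x y
    using that G edge[of x y] by (auto simp: std_graph_iff edge_weight_def split: if_splits)
  have "(u, v) \<in> (parcs G)\<^sup>*" using G u v by (simp add: std_graph_iff)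
  then show ?thesis by (induct rule: rtrancl_induct) (auto dest: step)
qed

text \<open>
  Functions that vanish off the vertex set, have mean zero and unit norm form a compact set in
  the product topology, so the Dirichlet form attains its minimum there. Homogeneity extends the
  minimality to all functions of mean zero.
\<close>

lemma exists_rayleigh_minimizer:
  assumes G: "std_graph G"
  obtains g where "vertex_inner G g (\<lambda>_. 1) = 0" "vertex_inner G g g = 1"
    "\<And>h. vertex_inner G h (\<lambda>_. 1) = 0 \<Longrightarrow> dirichlet_form G g g * vertex_inner G h h \<le> dirichlet_form G h h"
proof -
  let ?V = "pverts G" and ?w = "vertex_weight G"
  have fin: "finite ?V" using G by (simp add: std_graph_iff)
  have w1: "1 \<le> ?w v" if "v \<in> ?V" for v using vertex_weight_ge_1[OF G that] .
  define K where "K = PiE UNIV (\<lambda>v. if v \<in> ?V then {-1..1::real} else {0}) \<inter>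
     ({g. vertex_inner G g (\<lambda>_. 1) = 0} \<inter> {g. vertex_inner G g g = 1})"
  have cont: "continuous_on UNIV (\<lambda>g::'a \<Rightarrow> real. g v)" for v
    by (rule continuous_on_product_coordinates)
  have "compact (PiE UNIV (\<lambda>v. if v \<in> ?V then {-1..1::real} else {0}))"
    unfolding compactin_euclidean_iff[symmetric] euclidean_product_topology[symmetric] compactin_PiE by auto
  moreover have "closed {g::'a \<Rightarrow> real. vertex_inner G g (\<lambda>_. 1) = 0}"
    unfolding vertex_inner_def by (intro closed_Collect_eq continuous_intros cont)
  moreover have "closed {g::'a \<Rightarrow> real. vertex_inner G g g = 1}"
    unfolding vertex_inner_def by (intro closed_Collect_eq continuous_intros cont)
  ultimately have K: "compact K" unfolding K_def by (intro compact_Int_closed closed_Int)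
  have normalise: "\<exists>k\<in>K. dirichlet_form G h h = vertex_inner G h h * dirichlet_form G k k"
    if h: "vertex_inner G h (\<lambda>_. 1) = 0" and pos: "vertex_inner G h h > 0" for h
  proof -
    define c where "c = 1 / sqrt (vertex_inner G h h)"
    define k where "k = (\<lambda>v. if v \<in> ?V then c * h v else 0)"
    have c: "c * c * vertex_inner G h h = 1" using pos by (simp add: c_def)
    have eq: "vertex_inner G k k = 1" "vertex_inner G k (\<lambda>_. 1) = 0"
    proof -
      have "vertex_inner G k k = vertex_inner G (\<lambda>v. c * h v) (\<lambda>v. c * h v)"
        by (simp add: vertex_inner_def k_def cong: sum.cong)
      then show "vertex_inner G k k = 1" using c by (simp add: vertex_inner_simps mult.assoc)
      have "vertex_inner G k (\<lambda>_. 1) = vertex_inner G (\<lambda>v. c * h v) (\<lambda>_. 1)"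
        by (simp add: vertex_inner_def k_def cong: sum.cong)
      then show "vertex_inner G k (\<lambda>_. 1) = 0" using h by (simp add: vertex_inner_simps)
    qed
    have "\<bar>k v\<bar> \<le> 1" if v: "v \<in> ?V" for v
    proof -
      have "?w v * (k v * k v) \<le> vertex_inner G k k"
        unfolding vertex_inner_def by (rule member_le_sum[OF v]) (use w1 fin in \<open>force+\<close>)
      moreover have "1 * (k v * k v) \<le> ?w v * (k v * k v)"
        by (rule mult_right_mono) (use w1 v in auto)
      ultimately have "k v * k v \<le> 1" using eq by simp
      then show ?thesis by (metis abs_square_le_1 power2_eq_square)
    qed
    then have "k \<in> K" using eq by (auto simp: K_def k_def abs_le_iff minus_le_iff)
    moreover have "dirichlet_form G k k = c * c * dirichlet_form G h h"
    proof -
      have "dirichlet_form G k k = dirichlet_form G (\<lambda>v. c * h v) (\<lambda>v. c * h v)"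
        by (simp add: dirichlet_form_def k_def cong: sum.cong)
      then show ?thesis by (simp add: dirichlet_form_simps)
    qed
    ultimately show ?thesis using c by (metis mult.commute mult.assoc mult_1)
  qed
  obtain a b where ab: "a \<in> ?V" "b \<in> ?V" "a \<noteq> b"
    using G fin by (metis One_nat_def Suc_1 card_le_Suc0_iff_eq std_graph_iff not_less_eq_eq)
  \<comment> \<open>A nonzero function of mean zero, which exists because there are two vertices.\<close>
  define h where "h = (\<lambda>v. (if v = a then ?w b else 0) + (if v = b then - ?w a else 0))"
  have "vertex_inner G h (\<lambda>_. 1) = 0"
  proof -
    have "?w v * (h v * 1) = (if v = a then ?w a * ?w b else 0) + (if v = b then - (?w a * ?w b) else 0)" for v
      by (auto simp: h_def)
    then show ?thesis using ab fin by (simp add: vertex_inner_def sum.distrib del: mult_1_right)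
  qed
  moreover have "vertex_inner G h h > 0"
  proof -
    have "0 < ?w a * (h a * h a)" using w1[OF ab(1)] w1[OF ab(2)] ab by (simp add: h_def)
    also have "\<dots> \<le> vertex_inner G h h"
      unfolding vertex_inner_def by (rule member_le_sum[OF ab(1)]) (use w1 fin in \<open>force+\<close>)
    finally show ?thesis .
  qed
  ultimately have "K \<noteq> {}" using normalise by blast
  moreover have "continuous_on K (\<lambda>g. dirichlet_form G g g)"
    unfolding dirichlet_form_def
    by (intro continuous_intros continuous_on_subset[OF cont]) auto
  ultimately obtain g where g: "g \<in> K" "\<And>k. k \<in> K \<Longrightarrow> dirichlet_form G g g \<le> dirichlet_form G k k"
    using continuous_attains_inf[OF K] by blast
  show thesis
  proof
    show "vertex_inner G g (\<lambda>_. 1) = 0" "vertex_inner G g g = 1" using g by (auto simp: K_def)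
    fix h assume h: "vertex_inner G h (\<lambda>_. 1) = 0"
    have nn: "0 \<le> vertex_inner G h h"
      unfolding vertex_inner_def by (rule sum_nonneg) (use w1 in force)
    show "dirichlet_form G g g * vertex_inner G h h \<le> dirichlet_form G h h"
    proof (cases "vertex_inner G h h = 0")
      case True
      then show ?thesis by (auto simp: dirichlet_form_def edge_weight_nonneg intro!: sum_nonneg)
    next
      case False
      then have "vertex_inner G h h > 0" using nn by simp
      then obtain k where "k \<in> K" "dirichlet_form G h h = vertex_inner G h h * dirichlet_form G k k"
        using normalise[OF h] by blast
      then show ?thesis using mult_left_mono[OF g(2) nn, of k] by (simp add: mult.commute)
    qed
  qed
qed

text \<open>
  A minimizer of the Rayleigh quotient on mean-zero functions is an eigenfunction, by the first
  variation. Its eigenvalue is positive by connectedness, and is the least positive one because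
  eigenfunctions of positive eigenvalues have mean zero. So the minimum is the linear spectral gap,
  and its minimality is the Poincare inequality.
\<close>

lemma linear_gap_poincare:
  assumes G: "std_graph G"
  shows "0 < linear_gap G"
    and "vertex_inner G h (\<lambda>_. 1) = 0 \<Longrightarrow> 2 * linear_gap G * vertex_inner G h h \<le> dirichlet_form G h h"
proof -
  let ?V = "pverts G" and ?w = "vertex_weight G"
  have fin: "finite ?V" using G by (simp add: std_graph_iff)
  have w1: "1 \<le> ?w v" if "v \<in> ?V" for v using vertex_weight_ge_1[OF G that] .
  obtain g where g: "vertex_inner G g (\<lambda>_. 1) = 0" "vertex_inner G g g = 1"
    and min: "\<And>h. vertex_inner G h (\<lambda>_. 1) = 0 \<Longrightarrow> dirichlet_form G g g * vertex_inner G h h \<le> dirichlet_form G h h"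
    using exists_rayleigh_minimizer[OF G] by blast
  define \<kappa> where "\<kappa> = dirichlet_form G g g / 2"
  have \<kappa>: "dirichlet_form G g g = 2 * \<kappa>" by (simp add: \<kappa>_def)
  have "g v = 0" if "dirichlet_form G g g = 0" "v \<in> ?V" for v
  proof -
    have "vertex_inner G g (\<lambda>_. 1) = g v * (\<Sum>u\<in>?V. ?w u)"
      unfolding vertex_inner_def sum_distrib_left
      by (rule sum.cong) (use dirichlet_form_eq_0_imp_constant[OF G that(1) _ that(2)] in auto)
    moreover have "(\<Sum>u\<in>?V. ?w u) > 0"
      using fin that w1 by (intro sum_pos) force+
    ultimately show ?thesis using g by simp
  qed
  then have "dirichlet_form G g g \<noteq> 0" using g(2) by (auto simp: vertex_inner_def)
  moreover have "dirichlet_form G g g \<ge> 0" by (auto simp: dirichlet_form_def edge_weight_nonneg intro!: sum_nonneg)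
  ultimately have pos: "0 < \<kappa>" by (simp add: \<kappa>_def)
  \<comment> \<open>The first variation of the Rayleigh quotient at its minimizer vanishes in mean-zero directions.\<close>
  have ortho: "dirichlet_form G g h = 2 * \<kappa> * vertex_inner G g h" if h: "vertex_inner G h (\<lambda>_. 1) = 0" for h
  proof -
    have "2 * (dirichlet_form G g h - 2 * \<kappa> * vertex_inner G g h) = 0"
    proof (rule linear_term_eq_0)
      fix t :: real
      have "vertex_inner G (\<lambda>v. g v + t * h v) (\<lambda>_. 1) = 0" using g h by (simp add: vertex_inner_simps)
      from min[OF this]
      show "0 \<le> t * (2 * (dirichlet_form G g h - 2 * \<kappa> * vertex_inner G g h)) + t\<^sup>2 * (dirichlet_form G h h - 2 * \<kappa> * vertex_inner G h h)"
        by (simp add: vertex_inner_simps dirichlet_form_simps g \<kappa> dirichlet_form_commute[of G h g]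
            vertex_inner_commute[of G h g] algebra_simps power2_eq_square)
    qed
    then show ?thesis by simp
  qed
  have lap: "laplacian G g v = \<kappa> * g v" if v: "v \<in> ?V" for v
  proof -
    \<comment> \<open>Testing against the indicator of a vertex, corrected by a constant to have mean zero.\<close>
    define \<delta> where "\<delta> = (\<lambda>u. if u = v then 1 else 0::real)"
    define M where "M = vertex_inner G (\<lambda>_. 1) (\<lambda>_. 1)"
    have M: "M > 0" unfolding M_def vertex_inner_def using fin v w1 by (intro sum_pos) force+
    define c where "c = - vertex_inner G \<delta> (\<lambda>_. 1) / M"
    have "vertex_inner G (\<lambda>u. \<delta> u + c * 1) (\<lambda>_. 1) = 0"
      unfolding vertex_inner_simps using M by (simp add: c_def flip: M_def)
    from ortho[OF this] have "dirichlet_form G g \<delta> = 2 * \<kappa> * vertex_inner G g \<delta>"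
      unfolding vertex_inner_simps dirichlet_form_simps using g by simp
    then have "vertex_inner G (laplacian G g) \<delta> = \<kappa> * vertex_inner G g \<delta>"
      by (simp add: dirichlet_form_eq_laplacian[OF G])
    then have "?w v * laplacian G g v = \<kappa> * (?w v * g v)"
      using fin v by (simp add: vertex_inner_def \<delta>_def if_distrib cong: if_cong)
    then show ?thesis using w1[OF v] by (simp add: mult.left_commute)
  qed
  have "linear_gap G = \<kappa>"
    unfolding linear_gap_def
  proof (rule Least_equality)
    have "\<exists>v\<in>?V. g v \<noteq> 0"
    proof (rule ccontr)
      assume "\<not> ?thesis"
      then have "vertex_inner G g g = 0" by (simp add: vertex_inner_def)
      then show False using g(2) by simp
    qed
    then show "0 < \<kappa> \<and> laplacian_eigenvalue G \<kappa>"
      using pos lap unfolding laplacian_eigenvalue_def by blast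
    fix \<mu> assume \<mu>: "0 < \<mu> \<and> laplacian_eigenvalue G \<mu>"
    then obtain f v where f: "v \<in> ?V" "f v \<noteq> 0" "\<And>v. v \<in> ?V \<Longrightarrow> laplacian G f v = \<mu> * f v"
      unfolding laplacian_eigenvalue_def by blast
    have eq: "vertex_inner G (laplacian G f) h = \<mu> * vertex_inner G f h" for h
      using f by (simp add: vertex_inner_def sum_distrib_left mult_ac cong: sum.cong)
    have "\<mu> * vertex_inner G f (\<lambda>_. 1) = 0"
      using dirichlet_form_eq_laplacian[OF G, of f "\<lambda>_. 1"] by (simp add: eq dirichlet_form_simps)
    then have "vertex_inner G f (\<lambda>_. 1) = 0" using \<mu> by simp
    from min[OF this] have "2 * \<kappa> * vertex_inner G f f \<le> 2 * \<mu> * vertex_inner G f f"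
      by (simp add: dirichlet_form_eq_laplacian[OF G] eq \<kappa>[unfolded dirichlet_form_eq_laplacian[OF G]])
    moreover have "vertex_inner G f f > 0"
    proof -
      have "0 < ?w v * (f v * f v)" using w1[OF f(1)] f by (force simp: zero_less_mult_iff)
      also have "\<dots> \<le> vertex_inner G f f"
        unfolding vertex_inner_def by (rule member_le_sum[OF f(1)]) (use w1 fin in \<open>force+\<close>)
      finally show ?thesis .
    qed
    ultimately show "\<kappa> \<le> \<mu>" by simp
  qed
  then show "0 < linear_gap G"
    and "vertex_inner G h (\<lambda>_. 1) = 0 \<Longrightarrow> 2 * linear_gap G * vertex_inner G h h \<le> dirichlet_form G h h"
    using pos min[of h] \<kappa> by simp_all
qed

section \<open>Convexity and barycenters in CAT(0) spaces\<close>

text \<open>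
  The comparison triangle: for \<open>a > 0\<close> the side of length \<open>a\<close> is placed on the first axis, the third vertex has
  first coordinate \<open>u\<close> given by the law of cosines, and the triangle inequalities amount to
  \<open>\<bar>u\<bar> \<le> c\<close>.
\<close>

lemma exists_plane_triangle:
  fixes a b c :: real
  assumes "0 \<le> a" "0 \<le> b" "0 \<le> c" "a \<le> b + c" "b \<le> c + a" "c \<le> a + b"
  obtains x y z :: "real^2" where "dist x y = a" "dist y z = b" "dist z x = c"
proof (cases "a = 0")
  case True
  then have "b = c" using assms by simp
  have "norm (axis 1 c :: real^2) = c"
    using assms by (simp add: norm_vec_def L2_set_def sum_2 axis_def)
  then have "dist (0::real^2) 0 = a" "dist 0 (axis 1 c :: real^2) = b" "dist (axis 1 c :: real^2) 0 = c"
    using True \<open>b = c\<close> by (simp_all add: dist_norm)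
  then show ?thesis by (rule that)
next
  case False
  then have a: "a > 0" using assms by simp
  define u where "u = (a\<^sup>2 + c\<^sup>2 - b\<^sup>2) / (2 * a)"
  have ua: "2 * a * u = a\<^sup>2 + c\<^sup>2 - b\<^sup>2" using a by (simp add: u_def)
  have "\<bar>2 * a * u\<bar> \<le> 2 * a * c"
  proof (rule abs_leI)
    have "(a - c)\<^sup>2 \<le> b\<^sup>2" using assms by (intro abs_le_square_iff[THEN iffD1]) auto
    then show "2 * a * u \<le> 2 * a * c" unfolding ua by (simp add: power2_eq_square algebra_simps)
    have "b\<^sup>2 \<le> (c + a)\<^sup>2" using assms by (intro power_mono) auto
    then show "- (2 * a * u) \<le> 2 * a * c" unfolding ua by (simp add: power2_eq_square algebra_simps)
  qed
  then have "\<bar>u\<bar> \<le> c" using a by (simp add: abs_mult)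
  then have "u\<^sup>2 \<le> c\<^sup>2" using assms by (simp add: abs_le_square_iff[symmetric])
  then obtain w where w: "w\<^sup>2 = c\<^sup>2 - u\<^sup>2" by (metis diff_ge_0_iff_ge real_sqrt_pow2)
  define x y z :: "real^2" where "x = 0" and "y = (\<chi> i. if i = 1 then a else 0)"
    and "z = (\<chi> i. if i = 1 then u else w)"
  have "(2::2) \<noteq> 1" by simp
  have "dist x y = a" using a by (simp add: x_def y_def dist_vec_def L2_set_def sum_2)
  moreover have "dist z x = c" using assms w by (simp add: x_def z_def dist_vec_def L2_set_def sum_2)
  moreover have "dist y z = b"
  proof -
    have "(a - u)\<^sup>2 + w\<^sup>2 = b\<^sup>2" using w ua by (simp add: power2_eq_square algebra_simps)
    then show ?thesis using assms by (simp add: y_def z_def dist_vec_def L2_set_def sum_2 dist_real_def)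
  qed
  ultimately show ?thesis by (intro that)
qed

text \<open>
  Stewart's theorem, which turns the comparison of a vertex with a point of the opposite side into
  the convexity inequality below.
\<close>

lemma stewart_identity:
  fixes x y z :: "'a::real_inner"
  shows "(dist (x + s *\<^sub>R (y - x)) z)\<^sup>2 = (1 - s) * (dist z x)\<^sup>2 + s * (dist z y)\<^sup>2 - s * (1 - s) * (dist x y)\<^sup>2"
proof -
  define u v where "u = z - x" and "v = y - x"
  have "x + s *\<^sub>R (y - x) - z = s *\<^sub>R v - u" "z - x = u" "z - y = u - v" "x - y = - v"
    by (simp_all add: u_def v_def)
  then show ?thesis
    unfolding dist_norm power2_norm_eq_inner
    by (simp only: inner_diff_left inner_diff_right inner_scaleR_left inner_scaleR_right
        inner_minus_left inner_minus_right inner_commute[of v u]) (simp add: field_simps)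
qed

lemma geodesic_path_in:
  "geodesic_path X c x y \<Longrightarrow> 0 \<le> s \<Longrightarrow> s \<le> mdist X x y \<Longrightarrow> c s \<in> mspace X"
  by (auto simp: geodesic_path_def Pi_iff)

lemma geodesic_path_dist:
  assumes "geodesic_path X c x y" "0 \<le> s" "s \<le> mdist X x y"
  shows "mdist X x (c s) = s" "mdist X (c s) y = mdist X x y - s"
proof -
  have ends: "c 0 = x" "c (mdist X x y) = y"
    and dist: "\<And>s t. s \<in> {0..mdist X x y} \<Longrightarrow> t \<in> {0..mdist X x y} \<Longrightarrow> mdist X (c s) (c t) = \<bar>s - t\<bar>"
    using assms(1) unfolding geodesic_path_def by blast+
  show "mdist X x (c s) = s" "mdist X (c s) y = mdist X x y - s"
    using dist[of 0 s] dist[of s "mdist X x y"] assms(2,3) by (simp_all add: ends)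
qed

lemma CAT0_geodesic_path:
  assumes "CAT0 X" "x \<in> mspace X" "y \<in> mspace X"
  obtains c where "geodesic_path X c x y"
  using assms unfolding CAT0_def geodesic_space_def geodesic_segment_def by blast

text \<open>
  Squared distance functions are at least as convex along geodesics as in the plane: compare the
  point at parameter \<open>s\<close> of the side from \<open>x\<close> to \<open>y\<close> with the opposite vertex \<open>z\<close>. The contraction
  property and the barycenters both rest on this inequality.
\<close>

lemma CAT0_comparison_inequality:
  assumes X: "CAT0 X" and x: "x \<in> mspace X" and y: "y \<in> mspace X" and z: "z \<in> mspace X"
    and c: "geodesic_path X c x y" and s: "0 \<le> s" "s \<le> 1"
  shows "(mdist X (c (s * mdist X x y)) z)\<^sup>2 \<le>
     (1 - s) * (mdist X z x)\<^sup>2 + s * (mdist X z y)\<^sup>2 - s * (1 - s) * (mdist X x y)\<^sup>2"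
proof -
  let ?d = "mdist X x y"
  define A where "A = c ` {0..?d}"
  have A: "geodesic_segment X x y A" using c by (auto simp: geodesic_segment_def A_def)
  obtain B where B: "geodesic_segment X y z B" using X y z unfolding CAT0_def geodesic_space_def by blast
  obtain C where C: "geodesic_segment X z x C" using X x z unfolding CAT0_def geodesic_space_def by blast
  obtain x' y' z' :: "real^2" where d: "dist x' y' = mdist X x y" "dist y' z' = mdist X y z" "dist z' x' = mdist X z x"
  proof (rule exists_plane_triangle)
    show "mdist X x y \<le> mdist X y z + mdist X z x" using mdist_triangle[of x X z y] x y z by (simp add: mdist_commute)
    show "mdist X y z \<le> mdist X z x + mdist X x y" using mdist_triangle[of y X x z] x y z by (simp add: mdist_commute)
    show "mdist X z x \<le> mdist X x y + mdist X y z" using mdist_triangle[of z X y x] x y z by (simp add: mdist_commute)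
  qed auto
  define p' where "p' = x' + s *\<^sub>R (y' - x')"
  have sd: "0 \<le> s * ?d" "s * ?d \<le> ?d" using s by (auto simp: mult_left_le_one_le)
  have "comparison_point X x A x' y' (c (s * ?d)) p'"
    unfolding comparison_point_def
  proof (intro conjI)
    show "c (s * ?d) \<in> A" using sd by (auto simp: A_def)
    show "p' \<in> closed_segment x' y'" using s by (auto simp: p'_def closed_segment_def algebra_simps intro!: exI[of _ s])
    have "dist x' p' = s * dist x' y'" using s by (simp add: p'_def dist_norm norm_minus_commute)
    then show "dist x' p' = mdist X x (c (s * ?d))" using geodesic_path_dist[OF c sd] d by simp
  qed
  moreover have "comparison_point X y B y' z' z z'"
    unfolding comparison_point_def
  proof (intro conjI)
    obtain e where "geodesic_path X e y z" "B = e ` {0..mdist X y z}"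
      using B unfolding geodesic_segment_def by blast
    then show "z \<in> B" by (auto simp: geodesic_path_def intro!: image_eqI[of z e "mdist X y z"])
  qed (use d in auto)
  ultimately have "mdist X (c (s * ?d)) z \<le> dist p' z'"
    by (intro X[unfolded CAT0_def Let_def, THEN conjunct2, rule_format, OF x y z, of A B C x' y' z' "c (s * ?d)" p' z z'])
      (simp_all add: A B C d)
  then have "(mdist X (c (s * ?d)) z)\<^sup>2 \<le> (dist p' z')\<^sup>2" by (simp add: power_mono)
  moreover have "dist z' y' = mdist X z y" using d(2) by (simp add: dist_commute mdist_commute)
  moreover have "(dist p' z')\<^sup>2 = (1 - s) * (dist z' x')\<^sup>2 + s * (dist z' y')\<^sup>2 - s * (1 - s) * (dist x' y')\<^sup>2"
    unfolding p'_def by (rule stewart_identity)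
  ultimately show ?thesis by (simp only: d(1) d(3))
qed

text \<open>
  The comparison inequality is applied twice, first to the geodesic from \<open>p\<close> to \<open>y\<close> as seen from \<open>x\<close>,
  then to the geodesic from \<open>p\<close> to \<open>x\<close> as seen from the contracted image of \<open>y\<close>; the terms in
  the distances to \<open>p\<close> cancel.
\<close>

lemma CAT0_contraction:
  assumes X: "CAT0 X" and p: "p \<in> mspace X" and x: "x \<in> mspace X" and y: "y \<in> mspace X"
    and c: "geodesic_path X c p x" and e: "geodesic_path X e p y" and t: "0 \<le> t" "t \<le> 1"
  shows "mdist X (c (t * mdist X p x)) (e (t * mdist X p y)) \<le> t * mdist X x y"
proof -
  let ?a = "mdist X p x" and ?b = "mdist X p y" and ?d = "mdist X x y"
  define y' where "y' = e (t * ?b)"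
  have tb: "0 \<le> t * ?b" "t * ?b \<le> ?b" using t by (auto simp: mult_left_le_one_le)
  have y': "y' \<in> mspace X" using geodesic_path_in[OF e tb] by (simp add: y'_def)
  have py': "mdist X y' p = t * ?b" using geodesic_path_dist[OF e tb] by (simp add: y'_def mdist_commute)
  have "(mdist X y' x)\<^sup>2 \<le> (1 - t) * ?a\<^sup>2 + t * ?d\<^sup>2 - t * (1 - t) * ?b\<^sup>2"
    using CAT0_comparison_inequality[OF X p y x e t] by (simp add: y'_def mdist_commute)
  then have "t * (mdist X y' x)\<^sup>2 \<le> t * ((1 - t) * ?a\<^sup>2 + t * ?d\<^sup>2 - t * (1 - t) * ?b\<^sup>2)"
    using t by (simp add: mult_left_mono)
  moreover have "(mdist X (c (t * ?a)) y')\<^sup>2 \<le> (1 - t) * (t * ?b)\<^sup>2 + t * (mdist X y' x)\<^sup>2 - t * (1 - t) * ?a\<^sup>2"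
    using CAT0_comparison_inequality[OF X p x y' c t] py' by simp
  ultimately have "(mdist X (c (t * ?a)) y')\<^sup>2 \<le> (t * ?d)\<^sup>2"
    by (simp add: power2_eq_square algebra_simps)
  then show ?thesis unfolding y'_def by (rule power2_le_imp_le) (use t in simp)
qed

text \<open>
  The weighted sum \<open>\<Phi>\<close> of squared distances is uniformly convex along geodesics. Comparing two
  almost minimizers with their midpoint shows that minimizing sequences are Cauchy; comparing the
  minimizer \<open>p\<close> with points of the geodesic to \<open>z\<close> that are close to \<open>p\<close> gives the quadratic growth.
\<close>

lemma CAT0_exists_barycenter:
  fixes w :: "'v \<Rightarrow> real"
  assumes X: "CAT0 X" and complete: "mcomplete_of X" and V: "finite V" "V \<noteq> {}"
    and w: "\<And>v. v \<in> V \<Longrightarrow> 0 < w v" and f: "f \<in> V \<rightarrow> mspace X"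
  obtains p where "p \<in> mspace X"
    "\<And>z. z \<in> mspace X \<Longrightarrow>
       (\<Sum>v\<in>V. w v * (mdist X p (f v))\<^sup>2) + sum w V * (mdist X p z)\<^sup>2 \<le> (\<Sum>v\<in>V. w v * (mdist X z (f v))\<^sup>2)"
proof -
  interpret M: Metric_space "mspace X" "mdist X" by (rule Metric_space_mspace_mdist)
  define \<Phi> where "\<Phi> z = (\<Sum>v\<in>V. w v * (mdist X z (f v))\<^sup>2)" for z
  have fX: "f v \<in> mspace X" if "v \<in> V" for v using f that by auto
  have M0: "sum w V > 0" using V w by (simp add: sum_pos)
  have \<Phi>0: "0 \<le> \<Phi> z" for z unfolding \<Phi>_def by (intro sum_nonneg) (use w in force)
  have convex: "\<Phi> (c (s * mdist X x y)) \<le> (1 - s) * \<Phi> x + s * \<Phi> y - s * (1 - s) * sum w V * (mdist X x y)\<^sup>2"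
    if "x \<in> mspace X" "y \<in> mspace X" "geodesic_path X c x y" "0 \<le> s" "s \<le> 1" for x y c s
  proof -
    have "\<Phi> (c (s * mdist X x y)) \<le>
      (\<Sum>v\<in>V. w v * ((1 - s) * (mdist X x (f v))\<^sup>2 + s * (mdist X y (f v))\<^sup>2 - s * (1 - s) * (mdist X x y)\<^sup>2))"
      unfolding \<Phi>_def
    proof (intro sum_mono mult_left_mono)
      fix v assume "v \<in> V"
      then show "(mdist X (c (s * mdist X x y)) (f v))\<^sup>2 \<le> (1 - s) * (mdist X x (f v))\<^sup>2 + s * (mdist X y (f v))\<^sup>2 - s * (1 - s) * (mdist X x y)\<^sup>2"
        using CAT0_comparison_inequality[OF X that(1,2) fX that(3-5)] by (simp add: mdist_commute)
    qed (use w in force)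
    also have "\<dots> = (1 - s) * \<Phi> x + s * \<Phi> y - s * (1 - s) * sum w V * (mdist X x y)\<^sup>2"
      by (simp add: \<Phi>_def algebra_simps sum.distrib sum_subtractf sum_distrib_left sum_distrib_right)
    finally show ?thesis .
  qed
  define I where "I = Inf (\<Phi> ` mspace X)"
  have bdd: "bdd_below (\<Phi> ` mspace X)" using \<Phi>0 by (auto intro!: bdd_belowI)
  have I: "I \<le> \<Phi> z" if "z \<in> mspace X" for z unfolding I_def using bdd that by (simp add: cInf_lower)
  have ne: "\<Phi> ` mspace X \<noteq> {}" using V fX by auto
  have "\<exists>z\<in>mspace X. \<Phi> z < I + inverse (real (Suc n))" for n
    using cInf_lessD[OF ne, of "I + inverse (real (Suc n))"] by (auto simp: I_def)
  then obtain \<sigma> where \<sigma>: "\<And>n. \<sigma> n \<in> mspace X" "\<And>n. \<Phi> (\<sigma> n) < I + inverse (real (Suc n))" by metis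
  have close: "sum w V * (mdist X x y)\<^sup>2 \<le> 4 * \<epsilon>"
    if xy: "x \<in> mspace X" "y \<in> mspace X" and le: "\<Phi> x \<le> I + \<epsilon>" "\<Phi> y \<le> I + \<epsilon>" for x y \<epsilon>
  proof -
    obtain c where c: "geodesic_path X c x y" using CAT0_geodesic_path[OF X xy] .
    have "I \<le> \<Phi> (c (1/2 * mdist X x y))" by (intro I geodesic_path_in[OF c]) auto
    also have "\<dots> \<le> (1 - 1/2) * \<Phi> x + 1/2 * \<Phi> y - 1/2 * (1 - 1/2) * sum w V * (mdist X x y)\<^sup>2"
      by (rule convex) (use xy c in auto)
    finally show ?thesis using le by (simp add: field_simps)
  qed
  have "M.MCauchy \<sigma>"
    unfolding M.MCauchy_def
  proof (intro conjI allI impI)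
    show "range \<sigma> \<subseteq> mspace X" using \<sigma> by auto
    fix \<epsilon> :: real assume \<epsilon>: "\<epsilon> > 0"
    define \<eta> where "\<eta> = sum w V * \<epsilon>\<^sup>2 / 5"
    have "\<eta> > 0" using M0 \<epsilon> by (simp add: \<eta>_def)
    then obtain N where N: "inverse (real (Suc N)) < \<eta>" using reals_Archimedean by blast
    show "\<exists>N. \<forall>n n'. N \<le> n \<longrightarrow> N \<le> n' \<longrightarrow> mdist X (\<sigma> n) (\<sigma> n') < \<epsilon>"
    proof (intro exI allI impI)
      fix m n assume mn: "N \<le> m" "N \<le> n"
      have small: "\<Phi> (\<sigma> k) \<le> I + \<eta>" if "N \<le> k" for k
      proof -
        have "inverse (real (Suc k)) \<le> inverse (real (Suc N))" using that by (simp add: le_imp_inverse_le)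
        then show ?thesis using \<sigma>(2)[of k] N by linarith
      qed
      have "sum w V * (mdist X (\<sigma> m) (\<sigma> n))\<^sup>2 \<le> 4 * \<eta>" using close small \<sigma> mn by blast
      also have "\<dots> < sum w V * \<epsilon>\<^sup>2" using M0 \<epsilon> by (simp add: \<eta>_def)
      finally have "(mdist X (\<sigma> m) (\<sigma> n))\<^sup>2 < \<epsilon>\<^sup>2" using M0 by simp
      then show "mdist X (\<sigma> m) (\<sigma> n) < \<epsilon>" by (rule power2_less_imp_less) (use \<epsilon> in simp)
    qed
  qed
  moreover have "M.mcomplete" using complete by (simp add: mcomplete_of_def)
  ultimately obtain p where p: "limitin M.mtopology \<sigma> p sequentially" unfolding M.mcomplete_def by blast
  then have pX: "p \<in> mspace X" using M.limitin_mspace by blast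
  have d0: "(\<lambda>n. mdist X p (\<sigma> n)) \<longlonglongrightarrow> 0"
    using p unfolding M.limitin_metric_dist_null mdist_commute[of X p] by blast
  have lim: "(\<lambda>n. \<Phi> (\<sigma> n)) \<longlonglongrightarrow> \<Phi> p"
    unfolding \<Phi>_def
  proof (intro tendsto_intros)
    fix v assume v: "v \<in> V"
    have "(\<lambda>n. mdist X (\<sigma> n) (f v) - mdist X p (f v)) \<longlonglongrightarrow> 0"
    proof (rule tendsto_rabs_zero_cancel, rule tendsto_sandwich[OF _ _ tendsto_const d0])
      have "\<bar>mdist X (\<sigma> n) (f v) - mdist X p (f v)\<bar> \<le> mdist X p (\<sigma> n)" for n
        using mdist_triangle[of "\<sigma> n" X p "f v"] mdist_triangle[of p X "\<sigma> n" "f v"] \<sigma>(1)[of n] pX fX[OF v]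
        by (auto simp: mdist_commute)
      then show "\<forall>\<^sub>F n in sequentially. \<bar>mdist X (\<sigma> n) (f v) - mdist X p (f v)\<bar> \<le> mdist X p (\<sigma> n)" by simp
    qed simp
    then show "(\<lambda>n. mdist X (\<sigma> n) (f v)) \<longlonglongrightarrow> mdist X p (f v)" by (simp add: LIM_zero_iff)
  qed
  have "(\<lambda>n. I + inverse (real (Suc n))) \<longlonglongrightarrow> I + 0"
    by (intro tendsto_intros LIMSEQ_inverse_real_of_nat)
  then have "\<Phi> p \<le> I"
    using LIMSEQ_le[OF lim] \<sigma>(2) by (fastforce intro: less_imp_le)
  show thesis
  proof
    show "p \<in> mspace X" by fact
    fix z assume z: "z \<in> mspace X"
    obtain c where c: "geodesic_path X c p z" using CAT0_geodesic_path[OF X pX z] .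
    have "\<Phi> p + (1 - s) * (sum w V * (mdist X p z)\<^sup>2) \<le> \<Phi> z" if s: "0 < s" "s < 1" for s
    proof -
      have "c (s * mdist X p z) \<in> mspace X"
        using s by (intro geodesic_path_in[OF c]) (auto simp: mult_left_le_one_le)
      then have "\<Phi> p \<le> \<Phi> (c (s * mdist X p z))" using I \<open>\<Phi> p \<le> I\<close> by force
      also have "\<dots> \<le> (1 - s) * \<Phi> p + s * \<Phi> z - s * (1 - s) * sum w V * (mdist X p z)\<^sup>2"
        by (rule convex[OF pX z c]) (use s in auto)
      finally have "s * (\<Phi> p + (1 - s) * (sum w V * (mdist X p z)\<^sup>2)) \<le> s * \<Phi> z" by (simp add: algebra_simps)
      then show ?thesis using s by simp
    qed
    then have "\<forall>\<^sub>F s in at_right 0. \<Phi> p + (1 - s) * (sum w V * (mdist X p z)\<^sup>2) \<le> \<Phi> z"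
      unfolding eventually_at_right_field by (intro exI[of _ 1]) auto
    moreover have "((\<lambda>s. \<Phi> p + (1 - s) * (sum w V * (mdist X p z)\<^sup>2)) \<longlongrightarrow> \<Phi> p + (1 - 0) * (sum w V * (mdist X p z)\<^sup>2)) (at_right 0)"
      by (intro tendsto_intros)
    ultimately have "\<Phi> p + (1 - 0) * (sum w V * (mdist X p z)\<^sup>2) \<le> \<Phi> z"
      by (intro tendsto_upperbound) auto
    then show "(\<Sum>v\<in>V. w v * (mdist X p (f v))\<^sup>2) + sum w V * (mdist X p z)\<^sup>2 \<le> (\<Sum>v\<in>V. w v * (mdist X z (f v))\<^sup>2)"
      by (simp add: \<Phi>_def)
  qed
qed

text \<open>
  Let \<open>D\<close> and \<open>b\<close> be the distances of \<open>f v\<close> from \<open>p\<close> and \<open>z\<close>, and \<open>a\<close> the distance of the contracted point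
  from \<open>z\<close>. The triangle inequality gives \<open>a - t D \<ge> b - D\<close>, whence
  \<open>a\<^sup>2 - (t D)\<^sup>2 \<ge> 2 t D (b - D) = t (b\<^sup>2 - D\<^sup>2) - t (b - D)\<^sup>2\<close>. The last square is at most \<open>d(p,z)\<^sup>2\<close>, and the
  quadratic growth of the sum of squared distances at the barycenter \<open>p\<close> compensates exactly this
  loss.
\<close>

lemma contracted_map_barycenter:
  fixes w :: "'v \<Rightarrow> real"
  assumes X: "CAT0 X" and w: "\<And>v. v \<in> V \<Longrightarrow> 0 \<le> w v" and f: "f \<in> V \<rightarrow> mspace X"
    and p: "p \<in> mspace X" and z: "z \<in> mspace X"
    and bary: "(\<Sum>v\<in>V. w v * (mdist X p (f v))\<^sup>2) + sum w V * (mdist X p z)\<^sup>2 \<le> (\<Sum>v\<in>V. w v * (mdist X z (f v))\<^sup>2)"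
    and c: "\<And>v. v \<in> V \<Longrightarrow> geodesic_path X (c v) p (f v)" and t: "0 \<le> t" "t \<le> 1"
  shows "(\<Sum>v\<in>V. w v * (mdist X p (c v (t * mdist X p (f v))))\<^sup>2) \<le>
    (\<Sum>v\<in>V. w v * (mdist X z (c v (t * mdist X p (f v))))\<^sup>2)"
proof -
  let ?D = "\<lambda>v. mdist X p (f v)" and ?b = "\<lambda>v. mdist X z (f v)"
  let ?a = "\<lambda>v. mdist X z (c v (t * ?D v))" and ?x = "mdist X p z"
  have tD: "0 \<le> t * ?D v" "t * ?D v \<le> ?D v" for v using t by (auto simp: mult_left_le_one_le)
  have pt: "(t * ?D v)\<^sup>2 + t * ((?b v)\<^sup>2 - (?D v)\<^sup>2 - ?x\<^sup>2) \<le> (?a v)\<^sup>2" if v: "v \<in> V" for v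
  proof -
    have fv: "f v \<in> mspace X" using f v by auto
    have "?b v \<le> ?a v + mdist X (c v (t * ?D v)) (f v)"
      by (rule mdist_triangle) (use z fv geodesic_path_in[OF c[OF v] tD] in auto)
    then have ab: "?b v - ?D v \<le> ?a v - t * ?D v"
      using geodesic_path_dist(2)[OF c[OF v] tD] by simp
    have "\<bar>?b v - ?D v\<bar> \<le> ?x"
      using mdist_triangle[of z X p "f v"] mdist_triangle[of p X z "f v"] z p fv by (auto simp: mdist_commute)
    then have "(?b v - ?D v)\<^sup>2 \<le> ?x\<^sup>2" using abs_le_square_iff[of "?b v - ?D v" ?x] by simp
    then have "t * ((?b v)\<^sup>2 - (?D v)\<^sup>2 - ?x\<^sup>2) \<le> t * (2 * ?D v * (?b v - ?D v))"
      using t by (intro mult_left_mono) (auto simp: power2_eq_square algebra_simps)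
    also have "\<dots> \<le> 2 * (t * ?D v) * (?a v - t * ?D v)"
      using mult_left_mono[OF ab, of "2 * (t * ?D v)"] tD by (simp add: mult_ac)
    also have "\<dots> \<le> (?a v)\<^sup>2 - (t * ?D v)\<^sup>2"
      using zero_le_power2[of "?a v - t * ?D v"] by (simp add: power2_eq_square algebra_simps)
    finally show ?thesis by simp
  qed
  have "0 \<le> t * ((\<Sum>v\<in>V. w v * (?b v)\<^sup>2) - (\<Sum>v\<in>V. w v * (?D v)\<^sup>2) - sum w V * ?x\<^sup>2)"
    using bary t by simp
  also have "\<dots> = (\<Sum>v\<in>V. w v * (t * ((?b v)\<^sup>2 - (?D v)\<^sup>2 - ?x\<^sup>2)))"
    by (simp add: sum_subtractf sum.distrib sum_distrib_left sum_distrib_right algebra_simps)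
  finally have "(\<Sum>v\<in>V. w v * (t * ?D v)\<^sup>2) \<le> (\<Sum>v\<in>V. w v * (t * ?D v)\<^sup>2) + (\<Sum>v\<in>V. w v * (t * ((?b v)\<^sup>2 - (?D v)\<^sup>2 - ?x\<^sup>2)))"
    by simp
  also have "\<dots> \<le> (\<Sum>v\<in>V. w v * (?a v)\<^sup>2)"
    unfolding sum.distrib[symmetric] distrib_left[symmetric] using pt w by (intro sum_mono mult_left_mono) auto
  finally show ?thesis
    using geodesic_path_dist(1)[OF c tD] by simp
qed

section \<open>Concentration of a map near its barycenter in a doubling space\<close>

text \<open>
  The radius is halved \<open>n\<close> times by covering each ball of the previous cover again.
\<close>

lemma doubling_iterated_cover:
  assumes doubling: "doubling N (submetric X U)" and U: "U \<subseteq> mspace X" and p: "p \<in> U" and r: "0 < r"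
  shows "\<exists>Z. finite Z \<and> real (card Z) \<le> N ^ n \<and> Z \<subseteq> U \<and>
    (\<forall>x\<in>U. mdist X p x \<le> r \<longrightarrow> (\<exists>z\<in>Z. mdist X z x \<le> r / 2 ^ n))"
proof (induction n)
  case 0
  show ?case by (intro exI[of _ "{p}"]) (use p in auto)
next
  case (Suc n)
  then obtain Z where Z: "finite Z" "real (card Z) \<le> N ^ n" "Z \<subseteq> U"
    "\<And>x. x \<in> U \<Longrightarrow> mdist X p x \<le> r \<Longrightarrow> \<exists>z\<in>Z. mdist X z x \<le> r / 2 ^ n"
    by blast
  have "\<exists>Y. finite Y \<and> real (card Y) \<le> N \<and> Y \<subseteq> U \<and>
      (\<forall>x\<in>U. mdist X q x \<le> r / 2 ^ n \<longrightarrow> (\<exists>z\<in>Y. mdist X z x \<le> r / 2 ^ Suc n))"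
    if q: "q \<in> Z" for q
  proof -
    have "q \<in> mspace (submetric X U)" "0 < r / 2 ^ n" using q Z U r by auto
    then obtain Y where Y: "finite Y" "real (card Y) \<le> N" "Y \<subseteq> mspace (submetric X U)"
      "mcball_of (submetric X U) q (r / 2 ^ n) \<subseteq> (\<Union>z\<in>Y. mcball_of (submetric X U) z (r / 2 ^ n / 2))"
      using doubling unfolding doubling_def by meson
    have "\<exists>z\<in>Y. mdist X z x \<le> r / 2 ^ Suc n" if "x \<in> U" "mdist X q x \<le> r / 2 ^ n" for x
    proof -
      have "x \<in> mcball_of (submetric X U) q (r / 2 ^ n)" using that q Z U by auto
      then have "x \<in> (\<Union>z\<in>Y. mcball_of (submetric X U) z (r / 2 ^ n / 2))" using Y(4) by blast
      then show ?thesis by (auto simp: mult.commute)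
    qed
    then show ?thesis using Y by auto
  qed
  then obtain Y where Y: "\<And>q. q \<in> Z \<Longrightarrow> finite (Y q) \<and> real (card (Y q)) \<le> N \<and> Y q \<subseteq> U \<and>
      (\<forall>x\<in>U. mdist X q x \<le> r / 2 ^ n \<longrightarrow> (\<exists>z\<in>Y q. mdist X z x \<le> r / 2 ^ Suc n))"
    by metis
  have N: "0 \<le> N"
  proof -
    have "mdist X p p = 0" using p U by (simp add: subsetD)
    then obtain q where "q \<in> Z" using Z(4)[OF p] r by auto
    then show ?thesis using Y[of q] by linarith
  qed
  show ?case
  proof (intro exI conjI ballI impI)
    show "finite (\<Union>(Y ` Z))" using Z Y by blast
    show "\<Union>(Y ` Z) \<subseteq> U" using Y by blast
    have "real (card (\<Union>(Y ` Z))) \<le> real (\<Sum>q\<in>Z. card (Y q))"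
      using card_UN_le[OF Z(1), of Y] by (simp only: of_nat_le_iff)
    also have "\<dots> \<le> real (card Z) * N"
      using Y by (simp add: sum_bounded_above)
    also have "\<dots> \<le> N ^ n * N" using Z N by (intro mult_right_mono) auto
    finally show "real (card (\<Union>(Y ` Z))) \<le> N ^ Suc n" by (simp add: mult.commute)
    fix x assume x: "x \<in> U" "mdist X p x \<le> r"
    then obtain q where "q \<in> Z" "mdist X q x \<le> r / 2 ^ n" using Z(4) by blast
    then show "\<exists>z\<in>\<Union>(Y ` Z). mdist X z x \<le> r / 2 ^ Suc n" using Y[of q] x by blast
  qed
qed

lemma weighted_variance:
  fixes w g :: "'v \<Rightarrow> real"
  assumes "(\<Sum>v\<in>V. w v * g v) = sum w V * \<gamma>"
  shows "(\<Sum>v\<in>V. w v * (g v)\<^sup>2) = (\<Sum>v\<in>V. w v * (g v - \<gamma>)\<^sup>2) + sum w V * \<gamma>\<^sup>2"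
proof -
  have "(\<Sum>v\<in>V. w v * (g v - \<gamma>)\<^sup>2) = (\<Sum>v\<in>V. w v * (g v)\<^sup>2 - 2 * \<gamma> * (w v * g v) + \<gamma>\<^sup>2 * w v)"
    by (intro sum.cong) (simp_all add: power2_eq_square algebra_simps)
  also have "\<dots> = (\<Sum>v\<in>V. w v * (g v)\<^sup>2) - 2 * \<gamma> * (sum w V * \<gamma>) + \<gamma>\<^sup>2 * sum w V"
    by (simp only: sum.distrib sum_subtractf sum_distrib_left[symmetric] assms)
  finally show ?thesis by (simp add: power2_eq_square)
qed

text \<open>
  If \<open>R\<close> is the mean of \<open>D\<close>, Markov's inequality leaves at least half of the weight on \<open>D \<le> 2 R\<close>. That
  part is covered by the at most \<open>K\<close> sets \<open>P z\<close>, one of which therefore has at least the share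
  \<open>1 / (2 K)\<close> of the total weight.
\<close>

lemma heavy_ball:
  fixes w :: "'v \<Rightarrow> real"
  assumes V: "finite V" and w: "\<And>v. v \<in> V \<Longrightarrow> 0 \<le> w v"
    and Z: "finite Z" and K: "real (card Z) \<le> K" "0 < K"
    and R: "0 < R" and mean: "(\<Sum>v\<in>V. w v * D v) = sum w V * R" and D: "\<And>v. v \<in> V \<Longrightarrow> 0 \<le> D v"
    and pos: "0 < sum w V"
    and cover: "\<And>v. v \<in> V \<Longrightarrow> D v \<le> 2 * R \<Longrightarrow> \<exists>z\<in>Z. P z v"
  shows "\<exists>z\<in>Z. sum w V \<le> 2 * K * (\<Sum>v\<in>{v\<in>V. P z v}. w v)"
proof (rule ccontr)
  assume none: "\<not> ?thesis"
  have lt: "2 * K * (\<Sum>v\<in>{v\<in>V. P z v}. w v) < sum w V" if "z \<in> Z" for z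
    using none that by force
  have "(\<Sum>v\<in>{v\<in>V. \<not> D v \<le> 2 * R}. w v) * (2 * R) = (\<Sum>v\<in>{v\<in>V. \<not> D v \<le> 2 * R}. w v * (2 * R))"
    by (simp add: sum_distrib_right)
  also have "\<dots> \<le> (\<Sum>v\<in>{v\<in>V. \<not> D v \<le> 2 * R}. w v * D v)"
    by (intro sum_mono mult_left_mono) (use w in auto)
  also have "\<dots> \<le> (\<Sum>v\<in>V. w v * D v)"
    using V w D by (intro sum_mono2) auto
  finally have "(\<Sum>v\<in>{v\<in>V. \<not> D v \<le> 2 * R}. w v) \<le> sum w V / 2" using R mean by simp
  moreover have "(\<Sum>v\<in>{v\<in>V. D v \<le> 2 * R}. w v) + (\<Sum>v\<in>{v\<in>V. \<not> D v \<le> 2 * R}. w v) = sum w V"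
    using V by (subst sum.union_disjoint[symmetric]) (auto intro!: sum.cong)
  ultimately have half: "sum w V / 2 \<le> (\<Sum>v\<in>{v\<in>V. D v \<le> 2 * R}. w v)" by linarith
  also have "\<dots> \<le> (\<Sum>v\<in>{v\<in>V. D v \<le> 2 * R}. \<Sum>z\<in>Z. if P z v then w v else 0)"
  proof (rule sum_mono)
    fix v assume v: "v \<in> {v \<in> V. D v \<le> 2 * R}"
    then obtain z where z: "z \<in> Z" "P z v" using cover by blast
    have "(if P z v then w v else 0) \<le> (\<Sum>z\<in>Z. if P z v then w v else 0)"
      by (rule member_le_sum[OF z(1)]) (use Z w v in auto)
    then show "w v \<le> (\<Sum>z\<in>Z. if P z v then w v else 0)" using z by simp
  qed
  also have "\<dots> \<le> (\<Sum>v\<in>V. \<Sum>z\<in>Z. if P z v then w v else 0)"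
    using V w by (intro sum_mono2) (auto intro!: sum_nonneg)
  also have "\<dots> = (\<Sum>z\<in>Z. \<Sum>v\<in>{v\<in>V. P z v}. w v)"
    using V by (subst sum.swap) (simp add: sum.inter_filter)
  finally have le: "sum w V / 2 \<le> (\<Sum>z\<in>Z. \<Sum>v\<in>{v\<in>V. P z v}. w v)" .
  then have "Z \<noteq> {}" using pos by auto
  then have "(\<Sum>z\<in>Z. \<Sum>v\<in>{v\<in>V. P z v}. w v) < (\<Sum>z\<in>Z. sum w V / (2 * K))"
    using lt K Z by (intro sum_strict_mono) (auto simp: field_simps)
  also have "\<dots> = real (card Z) * (sum w V / (2 * K))" by simp
  also have "\<dots> \<le> K * (sum w V / (2 * K))" using K pos by (intro mult_right_mono) auto
  finally show False using le K by simp
qed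

text \<open>
  Up to the factor \<open>\<kappa>\<close>, the energy \<open>E\<close> bounds the variances \<open>A\<close> and \<open>B\<close> of the distances from \<open>p\<close> and from the
  center \<open>z\<close> of a heavy ball of radius \<open>R / 2\<close>. With \<open>M\<close> the total weight, the first gives \<open>S = A + M R\<^sup>2\<close>.
  The mean distance \<open>\<gamma>\<close> from \<open>z\<close> exceeds \<open>R / 2\<close> by at most some \<open>\<delta>\<close> with \<open>M \<delta>\<^sup>2 \<le> 2 N\<^sup>2 B\<close>, since otherwise the heavy
  ball alone would make \<open>B\<close> too large. Hence
  \<open>M R\<^sup>2 \<le> S \<le> B + M \<gamma>\<^sup>2 \<le> B + M R\<^sup>2 / 2 + 2 M \<delta>\<^sup>2\<close>, where the middle inequality is the minimality of \<open>p\<close>.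
  This is \<open>M R\<^sup>2 \<le> (2 + 8 N\<^sup>2) B\<close>, and \<open>A\<close> contributes one more \<open>E\<close>.
\<close>

lemma barycenter_concentration:
  fixes w :: "'v \<Rightarrow> real"
  assumes V: "finite V" and w: "\<And>v. v \<in> V \<Longrightarrow> 0 \<le> w v" and pos: "0 < sum w V"
    and poincare: "\<And>g. (\<Sum>v\<in>V. w v * g v) = 0 \<Longrightarrow>
      \<kappa> * (\<Sum>v\<in>V. w v * (g v)\<^sup>2) \<le> (\<Sum>u\<in>V. \<Sum>v\<in>V. e u v * (g u - g v)\<^sup>2)"
    and \<kappa>: "0 \<le> \<kappa>" and e: "\<And>u v. 0 \<le> e u v"
    and doubling: "doubling N (submetric X U)" and N: "1 \<le> N" and U: "U \<subseteq> mspace X"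
    and f: "\<And>v. v \<in> V \<Longrightarrow> f v \<in> U" and p: "p \<in> U"
    and bary: "\<And>z. z \<in> U \<Longrightarrow> (\<Sum>v\<in>V. w v * (mdist X p (f v))\<^sup>2) \<le> (\<Sum>v\<in>V. w v * (mdist X z (f v))\<^sup>2)"
  shows "\<kappa> * (\<Sum>v\<in>V. w v * (mdist X p (f v))\<^sup>2) \<le>
    (3 + 8 * N\<^sup>2) * (\<Sum>u\<in>V. \<Sum>v\<in>V. e u v * (mdist X (f u) (f v))\<^sup>2)"
proof -
  define E where "E = (\<Sum>u\<in>V. \<Sum>v\<in>V. e u v * (mdist X (f u) (f v))\<^sup>2)"
  have E0: "0 \<le> E" unfolding E_def by (intro sum_nonneg mult_nonneg_nonneg e) auto
  have variance: "\<kappa> * (\<Sum>v\<in>V. w v * (mdist X z (f v) - \<gamma>)\<^sup>2) \<le> E"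
    if z: "z \<in> U" and \<gamma>: "(\<Sum>v\<in>V. w v * mdist X z (f v)) = sum w V * \<gamma>" for z \<gamma>
  proof -
    have "(\<Sum>v\<in>V. w v * (mdist X z (f v) - \<gamma>)) = 0"
      using \<gamma> by (simp add: right_diff_distrib sum_subtractf sum_distrib_right)
    from poincare[OF this] have "\<kappa> * (\<Sum>v\<in>V. w v * (mdist X z (f v) - \<gamma>)\<^sup>2) \<le>
        (\<Sum>u\<in>V. \<Sum>v\<in>V. e u v * (mdist X z (f u) - mdist X z (f v))\<^sup>2)" by simp
    also have "\<dots> \<le> E" unfolding E_def
    proof (intro sum_mono mult_left_mono e)
      fix u v assume "u \<in> V" "v \<in> V"
      then have "z \<in> mspace X" "f u \<in> mspace X" "f v \<in> mspace X" using z f U by auto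
      then have "\<bar>mdist X z (f u) - mdist X z (f v)\<bar> \<le> \<bar>mdist X (f u) (f v)\<bar>"
        using mdist_triangle[of z X "f u" "f v"] mdist_triangle[of z X "f v" "f u"] by (auto simp: mdist_commute)
      then show "(mdist X z (f u) - mdist X z (f v))\<^sup>2 \<le> (mdist X (f u) (f v))\<^sup>2"
        by (simp only: abs_le_square_iff)
    qed
    finally show ?thesis .
  qed
  define S where "S = (\<Sum>v\<in>V. w v * (mdist X p (f v))\<^sup>2)"
  define R where "R = (\<Sum>v\<in>V. w v * mdist X p (f v)) / sum w V"
  have mean: "(\<Sum>v\<in>V. w v * mdist X p (f v)) = sum w V * R" using pos by (simp add: R_def)
  have R0: "0 \<le> R" unfolding R_def using w pos by (intro divide_nonneg_pos sum_nonneg) auto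
  define A where "A = (\<Sum>v\<in>V. w v * (mdist X p (f v) - R)\<^sup>2)"
  have A: "\<kappa> * A \<le> E" unfolding A_def by (rule variance[OF p mean])
  have S: "S = A + sum w V * R\<^sup>2" unfolding S_def A_def by (rule weighted_variance[OF mean])
  have "\<kappa> * (sum w V * R\<^sup>2) \<le> (2 + 8 * N\<^sup>2) * E"
  proof (cases "R = 0")
    case True
    then show ?thesis using E0 N by simp
  next
    case False
    then have R: "0 < R" using R0 by simp
    obtain Z where Z: "finite Z" "real (card Z) \<le> N\<^sup>2" "Z \<subseteq> U"
      "\<And>x. x \<in> U \<Longrightarrow> mdist X p x \<le> 2 * R \<Longrightarrow> \<exists>z\<in>Z. mdist X z x \<le> 2 * R / 2 ^ 2"
      using doubling_iterated_cover[OF doubling U p, of "2 * R" 2] R by auto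
    have "\<exists>z\<in>Z. sum w V \<le> 2 * N\<^sup>2 * (\<Sum>v\<in>{v\<in>V. mdist X z (f v) \<le> R / 2}. w v)"
    proof (rule heavy_ball[OF V w Z(1,2) _ R mean _ pos])
      fix v assume "v \<in> V" "mdist X p (f v) \<le> 2 * R"
      then show "\<exists>z\<in>Z. mdist X z (f v) \<le> R / 2" using Z(4)[OF f] by simp
    qed (use N in auto)
    then obtain z where z: "z \<in> Z" and heavy: "sum w V \<le> 2 * N\<^sup>2 * (\<Sum>v\<in>{v\<in>V. mdist X z (f v) \<le> R / 2}. w v)"
      by blast
    have zU: "z \<in> U" using z Z by auto
    define \<gamma> where "\<gamma> = (\<Sum>v\<in>V. w v * mdist X z (f v)) / sum w V"
    have \<gamma>: "(\<Sum>v\<in>V. w v * mdist X z (f v)) = sum w V * \<gamma>" using pos by (simp add: \<gamma>_def)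
    define B where "B = (\<Sum>v\<in>V. w v * (mdist X z (f v) - \<gamma>)\<^sup>2)"
    have B: "\<kappa> * B \<le> E" unfolding B_def by (rule variance[OF zU \<gamma>])
    have B0: "0 \<le> B" unfolding B_def using w by (auto intro!: sum_nonneg)
    define \<delta> where "\<delta> = max 0 (\<gamma> - R / 2)"
    have "(\<Sum>v\<in>{v\<in>V. mdist X z (f v) \<le> R / 2}. w v) * \<delta>\<^sup>2 \<le> B"
    proof -
      have "(\<Sum>v\<in>{v\<in>V. mdist X z (f v) \<le> R / 2}. w v) * \<delta>\<^sup>2 = (\<Sum>v\<in>{v\<in>V. mdist X z (f v) \<le> R / 2}. w v * \<delta>\<^sup>2)"
        by (simp add: sum_distrib_right)
      also have "\<dots> \<le> (\<Sum>v\<in>{v\<in>V. mdist X z (f v) \<le> R / 2}. w v * (mdist X z (f v) - \<gamma>)\<^sup>2)"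
      proof (intro sum_mono mult_left_mono)
        fix v assume "v \<in> {v\<in>V. mdist X z (f v) \<le> R / 2}"
        then have "\<bar>\<delta>\<bar> \<le> \<bar>mdist X z (f v) - \<gamma>\<bar>" by (auto simp: \<delta>_def)
        then show "\<delta>\<^sup>2 \<le> (mdist X z (f v) - \<gamma>)\<^sup>2" by (simp only: abs_le_square_iff)
      qed (use w in auto)
      also have "\<dots> \<le> B" unfolding B_def using V w by (intro sum_mono2) auto
      finally show ?thesis .
    qed
    then have "2 * N\<^sup>2 * ((\<Sum>v\<in>{v\<in>V. mdist X z (f v) \<le> R / 2}. w v) * \<delta>\<^sup>2) \<le> 2 * N\<^sup>2 * B"
      by (intro mult_left_mono) auto
    moreover have "sum w V * \<delta>\<^sup>2 \<le> 2 * N\<^sup>2 * (\<Sum>v\<in>{v\<in>V. mdist X z (f v) \<le> R / 2}. w v) * \<delta>\<^sup>2"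
      using heavy by (intro mult_right_mono) auto
    ultimately have M\<delta>: "sum w V * \<delta>\<^sup>2 \<le> 2 * N\<^sup>2 * B" by (simp add: mult.assoc)
    have "0 \<le> \<gamma>" unfolding \<gamma>_def using w pos by (intro divide_nonneg_pos sum_nonneg) auto
    then have "\<gamma>\<^sup>2 \<le> (R / 2 + \<delta>)\<^sup>2" by (intro power_mono) (auto simp: \<delta>_def)
    also have "\<dots> \<le> R\<^sup>2 / 2 + 2 * \<delta>\<^sup>2"
      using zero_le_power2[of "R / 2 - \<delta>"] by (simp add: power2_eq_square algebra_simps)
    finally have "sum w V * \<gamma>\<^sup>2 \<le> sum w V * (R\<^sup>2 / 2 + 2 * \<delta>\<^sup>2)" using pos by (intro mult_left_mono) auto
    moreover have "S \<le> B + sum w V * \<gamma>\<^sup>2"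
      using bary[OF zU] weighted_variance[OF \<gamma>] by (simp add: S_def B_def)
    moreover have "0 \<le> A" unfolding A_def using w by (auto intro!: sum_nonneg)
    ultimately have "sum w V * R\<^sup>2 \<le> (2 + 8 * N\<^sup>2) * B"
      using S M\<delta> by (simp add: algebra_simps)
    then have "\<kappa> * (sum w V * R\<^sup>2) \<le> (2 + 8 * N\<^sup>2) * (\<kappa> * B)"
      using \<kappa> by (metis mult.left_commute mult_left_mono)
    also have "\<dots> \<le> (2 + 8 * N\<^sup>2) * E" using B by (intro mult_left_mono) auto
    finally show ?thesis .
  qed
  then show ?thesis using A S by (simp add: S_def[symmetric] E_def[symmetric] algebra_simps)
qed

section \<open>The lower bound for the nonlinear spectral gap\<close>

text \<open>
  The map is contracted towards its barycenter into a doubling neighborhood, where the concentration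
  estimate applies; the factor \<open>t\<^sup>2\<close> then cancels. The constant collects the factor 2 between the Dirichlet form and
  the Laplacian and the factor 4 from estimating distances by distances to the barycenter.
\<close>

lemma gromov_quotient_lower_bound:
  assumes G: "std_graph G" and X: "CAT0 X" "mcomplete_of X" "uniformly_locally_doubling N X" and N: "1 \<le> N"
    and f: "f \<in> pverts G \<rightarrow> mspace X" and nonconst: "\<exists>u\<in>pverts G. \<exists>v\<in>pverts G. f u \<noteq> f v"
  shows "linear_gap G / (2 * (3 + 8 * N\<^sup>2)) \<le> gromov_quotient G X f"
proof -
  let ?V = "pverts G" and ?w = "vertex_weight G" and ?e = "edge_weight G" and ?\<kappa> = "2 * linear_gap G"
  have V: "finite ?V" "?V \<noteq> {}" using G by (auto simp: std_graph_iff)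
  have w: "0 < ?w v" if "v \<in> ?V" for v using vertex_weight_ge_1[OF G that] by linarith
  have M: "0 < sum ?w ?V" using V w by (simp add: sum_pos)
  have poincare: "?\<kappa> * (\<Sum>v\<in>?V. ?w v * (g v)\<^sup>2) \<le> (\<Sum>u\<in>?V. \<Sum>v\<in>?V. ?e u v * (g u - g v)\<^sup>2)"
    if "(\<Sum>v\<in>?V. ?w v * g v) = 0" for g
    using linear_gap_poincare(2)[OF G, of g] that
    by (simp add: vertex_inner_def dirichlet_form_def power2_eq_square)
  obtain p where p: "p \<in> mspace X" and bary: "\<And>z. z \<in> mspace X \<Longrightarrow>
       (\<Sum>v\<in>?V. ?w v * (mdist X p (f v))\<^sup>2) + sum ?w ?V * (mdist X p z)\<^sup>2 \<le> (\<Sum>v\<in>?V. ?w v * (mdist X z (f v))\<^sup>2)"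
    using CAT0_exists_barycenter[of X ?V ?w f, OF X(1,2) V w f] by blast
  have fX: "f v \<in> mspace X" if "v \<in> ?V" for v using f that by auto
  obtain c where c: "\<And>v. v \<in> ?V \<Longrightarrow> geodesic_path X (c v) p (f v)"
  proof -
    have "\<exists>c. geodesic_path X c p (f v)" if "v \<in> ?V" for v
      using CAT0_geodesic_path[OF X(1) p fX[OF that]] by blast
    then show thesis using that by metis
  qed
  obtain U W where UW: "openin (mtopology_of X) W" "p \<in> W" "W \<subseteq> U" "U \<subseteq> mspace X" and doubling: "doubling N (submetric X U)"
    using X(3) p unfolding uniformly_locally_doubling_def by meson
  obtain r where r: "0 < r" "\<And>x. x \<in> mspace X \<Longrightarrow> mdist X p x < r \<Longrightarrow> x \<in> W"
  proof -
    interpret M: Metric_space "mspace X" "mdist X" by (rule Metric_space_mspace_mdist)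
    obtain r where "0 < r" "M.mball p r \<subseteq> W" using UW(1,2) M.openin_mtopology unfolding mtopology_of_def by blast
    then show thesis using that p by (auto simp: M.mball_def)
  qed
  define L where "L = (\<Sum>v\<in>?V. mdist X p (f v))"
  have L: "mdist X p (f v) \<le> L" if "v \<in> ?V" for v
    unfolding L_def by (rule member_le_sum[OF that]) (use V in auto)
  have L0: "0 \<le> L" unfolding L_def by (intro sum_nonneg) auto
  \<comment> \<open>As \<open>L\<close> bounds all distances to \<open>p\<close>, the contracted points are closer than \<open>r\<close> to \<open>p\<close>.\<close>
  define t where "t = min 1 (r / (2 * (L + 1)))"
  have t: "0 < t" "t \<le> 1" using r L0 by (auto simp: t_def)
  define F where "F v = c v (t * mdist X p (f v))" for v
  have tD: "0 \<le> t * mdist X p (f v)" "t * mdist X p (f v) \<le> mdist X p (f v)" for v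
    using t by (auto simp: mult_left_le_one_le)
  have pF: "mdist X p (F v) = t * mdist X p (f v)" if "v \<in> ?V" for v
    unfolding F_def using geodesic_path_dist(1)[OF c[OF that] tD] .
  have FW: "F v \<in> W" if v: "v \<in> ?V" for v
  proof (rule r(2))
    show "F v \<in> mspace X" unfolding F_def by (rule geodesic_path_in[OF c[OF v] tD])
    have "t * mdist X p (f v) \<le> (r / (2 * (L + 1))) * L"
      using L[OF v] t r L0 by (intro mult_mono) (auto simp: t_def)
    also have "\<dots> < r" using r L0 by (simp add: field_simps add_nonneg_pos)
    finally show "mdist X p (F v) < r" using pF[OF v] by simp
  qed
  have "?\<kappa> * (\<Sum>v\<in>?V. ?w v * (mdist X p (F v))\<^sup>2) \<le>
      (3 + 8 * N\<^sup>2) * (\<Sum>u\<in>?V. \<Sum>v\<in>?V. ?e u v * (mdist X (F u) (F v))\<^sup>2)"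
  proof (rule barycenter_concentration[OF V(1) _ M poincare _ edge_weight_nonneg doubling N UW(4)])
    show "(\<Sum>v\<in>?V. ?w v * (mdist X p (F v))\<^sup>2) \<le> (\<Sum>v\<in>?V. ?w v * (mdist X z (F v))\<^sup>2)" if "z \<in> U" for z
    proof -
      have z: "z \<in> mspace X" using that UW by auto
      show ?thesis unfolding F_def
        by (rule contracted_map_barycenter[OF X(1) _ f p z bary[OF z] c]) (use w t in force)+
    qed
  qed (use w FW UW linear_gap_poincare(1)[OF G] in force)+
  also have "\<dots> \<le> (3 + 8 * N\<^sup>2) * (\<Sum>u\<in>?V. \<Sum>v\<in>?V. ?e u v * (t * mdist X (f u) (f v))\<^sup>2)"
  proof (intro mult_left_mono sum_mono power_mono edge_weight_nonneg)
    fix u v assume "u \<in> ?V" "v \<in> ?V"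
    then show "mdist X (F u) (F v) \<le> t * mdist X (f u) (f v)"
      unfolding F_def using CAT0_contraction[OF X(1) p fX fX c c] t by simp
  qed auto
  also have "\<dots> = t\<^sup>2 * ((3 + 8 * N\<^sup>2) * (\<Sum>u\<in>?V. \<Sum>v\<in>?V. ?e u v * (mdist X (f u) (f v))\<^sup>2))"
    by (simp add: power_mult_distrib sum_distrib_left mult_ac)
  finally have "t\<^sup>2 * (?\<kappa> * (\<Sum>v\<in>?V. ?w v * (mdist X p (f v))\<^sup>2)) \<le>
      t\<^sup>2 * ((3 + 8 * N\<^sup>2) * (\<Sum>u\<in>?V. \<Sum>v\<in>?V. ?e u v * (mdist X (f u) (f v))\<^sup>2))"
    using pF by (simp add: power_mult_distrib sum_distrib_left mult_ac cong: sum.cong)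
  then have main: "?\<kappa> * (\<Sum>v\<in>?V. ?w v * (mdist X p (f v))\<^sup>2) \<le>
      (3 + 8 * N\<^sup>2) * (\<Sum>u\<in>?V. \<Sum>v\<in>?V. ?e u v * (mdist X (f u) (f v))\<^sup>2)"
    using t by (simp del: mult_le_cancel_left add: mult_le_cancel_left_pos)
  define T where "T = (\<Sum>u\<in>?V. \<Sum>v\<in>?V. ?w u * ?w v * (mdist X (f u) (f v))\<^sup>2)"
  let ?S = "\<Sum>v\<in>?V. ?w v * (mdist X p (f v))\<^sup>2"
  have "T \<le> (\<Sum>u\<in>?V. \<Sum>v\<in>?V. ?w u * ?w v * (2 * (mdist X p (f u))\<^sup>2 + 2 * (mdist X p (f v))\<^sup>2))"
    unfolding T_def
  proof (intro sum_mono mult_left_mono)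
    fix u v assume uv: "u \<in> ?V" "v \<in> ?V"
    have "mdist X (f u) (f v) \<le> mdist X p (f u) + mdist X p (f v)"
      using mdist_triangle[of "f u" X p "f v"] fX uv p by (simp add: mdist_commute)
    then have "(mdist X (f u) (f v))\<^sup>2 \<le> (mdist X p (f u) + mdist X p (f v))\<^sup>2" by (intro power_mono) auto
    also have "\<dots> \<le> 2 * (mdist X p (f u))\<^sup>2 + 2 * (mdist X p (f v))\<^sup>2"
      using zero_le_power2[of "mdist X p (f u) - mdist X p (f v)"] by (simp add: power2_eq_square algebra_simps)
    finally show "(mdist X (f u) (f v))\<^sup>2 \<le> 2 * (mdist X p (f u))\<^sup>2 + 2 * (mdist X p (f v))\<^sup>2" .
    show "0 \<le> ?w u * ?w v" using w[OF uv(1)] w[OF uv(2)] by simp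
  qed
  also have "\<dots> = (\<Sum>u\<in>?V. \<Sum>v\<in>?V. 2 * ((?w u * (mdist X p (f u))\<^sup>2) * ?w v) + 2 * (?w u * (?w v * (mdist X p (f v))\<^sup>2)))"
    by (intro sum.cong refl) (simp add: algebra_simps)
  also have "\<dots> = 4 * sum ?w ?V * ?S"
    by (simp only: sum.distrib sum_distrib_left[symmetric] sum_distrib_right[symmetric]) simp
  finally have T: "T / total_weight G \<le> 4 * ?S"
    using M by (simp add: total_weight_def field_simps)
  obtain a b where ab: "a \<in> ?V" "b \<in> ?V" "f a \<noteq> f b" using nonconst by blast
  have "0 < T"
  proof -
    have nn: "0 \<le> ?w u * ?w v * (mdist X (f u) (f v))\<^sup>2" if "u \<in> ?V" "v \<in> ?V" for u v
      using w[OF that(1)] w[OF that(2)] by simp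
    have "0 < ?w a * ?w b * (mdist X (f a) (f b))\<^sup>2"
      using w ab fX by simp
    also have "\<dots> \<le> (\<Sum>v\<in>?V. ?w a * ?w v * (mdist X (f a) (f v))\<^sup>2)"
      by (rule member_le_sum[OF ab(2)]) (use V nn ab in auto)
    also have "\<dots> \<le> T" unfolding T_def
      by (rule member_le_sum[OF ab(1)]) (use V nn in \<open>auto intro!: sum_nonneg\<close>)
    finally show ?thesis .
  qed
  then have T0: "0 < T / total_weight G" using M by (simp add: total_weight_def)
  define c' where "c' = 3 + 8 * N\<^sup>2"
  have c': "0 < c'" unfolding c'_def by (simp add: add_pos_nonneg)
  have "linear_gap G / (2 * c') * (T / total_weight G) \<le> linear_gap G / (2 * c') * (4 * ?S)"
    using T linear_gap_poincare(1)[OF G] c' by (intro mult_left_mono) auto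
  also have "\<dots> = ?\<kappa> * ?S / c'" using c' by (simp add: field_simps)
  also have "\<dots> \<le> (\<Sum>u\<in>?V. \<Sum>v\<in>?V. ?e u v * (mdist X (f u) (f v))\<^sup>2)"
    using main c' by (simp add: c'_def[symmetric] divide_le_eq mult.commute)
  finally show ?thesis
    unfolding gromov_quotient_def c'_def[symmetric] T_def[symmetric]
    using T0 by (subst pos_le_divide_eq) simp_all
qed

text \<open>
  The infimum defining the Gromov gap is over a nonempty set because graph and space have two
  points each.
\<close>

lemma gap_constant_exists:
  assumes N: "1 \<le> N"
  shows "gap_constant TYPE('v) TYPE('a) N (1 / (2 * (3 + 8 * N\<^sup>2)))"
  unfolding gap_constant_def
proof (intro allI impI, elim conjE)
  fix X :: "'a metric" and G :: "'v pair_pre_digraph"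
  assume two: "\<exists>x\<in>mspace X. \<exists>y\<in>mspace X. x \<noteq> y" and X: "mcomplete_of X" "CAT0 X" "uniformly_locally_doubling N X"
    and G: "std_graph G"
  obtain x y where xy: "x \<in> mspace X" "y \<in> mspace X" "x \<noteq> y" using two by blast
  obtain a b where ab: "a \<in> pverts G" "b \<in> pverts G" "a \<noteq> b"
    using G by (metis One_nat_def Suc_1 card_le_Suc0_iff_eq std_graph_iff not_less_eq_eq)
  show "1 / (2 * (3 + 8 * N\<^sup>2)) * linear_gap G \<le> gromov_gap G X"
    unfolding gromov_gap_def
  proof (rule cInf_greatest)
    have "(\<lambda>v. if v = a then x else y) \<in> pverts G \<rightarrow> mspace X" using xy by auto
    moreover have "\<exists>u\<in>pverts G. \<exists>v\<in>pverts G. (if u = a then x else y) \<noteq> (if v = a then x else y)"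
      using ab xy by (intro bexI[of _ a] bexI[of _ b]) auto
    ultimately show "{gromov_quotient G X f | f. f \<in> pverts G \<rightarrow> mspace X \<and> (\<exists>u\<in>pverts G. \<exists>v\<in>pverts G. f u \<noteq> f v)} \<noteq> {}"
      by blast
  next
    fix q assume "q \<in> {gromov_quotient G X f | f. f \<in> pverts G \<rightarrow> mspace X \<and> (\<exists>u\<in>pverts G. \<exists>v\<in>pverts G. f u \<noteq> f v)}"
    then show "1 / (2 * (3 + 8 * N\<^sup>2)) * linear_gap G \<le> q"
      using gromov_quotient_lower_bound[OF G X(2,1,3) N] by auto
  qed
qed

section \<open>Cardinality of uniformly locally doubling CAT(0) spaces\<close>

lemma UNION_lepoll_reals:
  assumes "I \<lesssim> (UNIV :: real set)" "\<And>i. i \<in> I \<Longrightarrow> B i \<lesssim> (UNIV :: real set)"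
  shows "(\<Union>i\<in>I. B i) \<lesssim> (UNIV :: real set)"
proof -
  have "ordLeq3 (card_of (\<Union>i\<in>I. B i)) (card_of (UNIV :: real set))"
    by (rule card_of_UNION_ordLeq_infinite)
      (use assms in \<open>auto simp: lepoll_def card_of_ordLeq[symmetric] infinite_UNIV_char_0\<close>)
  then show ?thesis unfolding card_of_ordLeq[symmetric] lepoll_def .
qed

text \<open>
  A point is determined by the set of those members of countably many finite nets, with radii
  tending to zero, that are close to it; there are continuum many sets of natural numbers.
\<close>

lemma doubling_lepoll_reals:
  assumes doubling: "doubling N (submetric X U)" and U: "U \<subseteq> mspace X" and p: "p \<in> U"
  shows "{x\<in>U. mdist X p x \<le> 1} \<lesssim> (UNIV :: real set)"
proof -
  have "\<forall>n. \<exists>Z. finite Z \<and> Z \<subseteq> U \<and> (\<forall>x\<in>U. mdist X p x \<le> 1 \<longrightarrow> (\<exists>z\<in>Z. mdist X z x \<le> 1 / 2 ^ n))"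
    using doubling_iterated_cover[OF doubling U p, of 1] by (metis zero_less_one)
  then obtain Z where Z: "\<And>n. finite (Z n)" "\<And>n. Z n \<subseteq> U"
    "\<And>n x. x \<in> U \<Longrightarrow> mdist X p x \<le> 1 \<Longrightarrow> \<exists>z\<in>Z n. mdist X z x \<le> 1 / 2 ^ n"
    by metis
  define C where "C = (SIGMA n:UNIV. Z n)"
  have C: "countable C" unfolding C_def using Z by (intro countable_SIGMA) (auto intro: countable_finite)
  define near where "near x = {(n, z). (n, z) \<in> C \<and> mdist X z x \<le> 1 / 2 ^ n}" for x
  have near_C: "near x \<subseteq> C" for x by (auto simp: near_def)
  have "inj_on (\<lambda>x. to_nat_on C ` near x) {x\<in>U. mdist X p x \<le> 1}"
  proof (rule inj_onI)
    fix x y assume x: "x \<in> {x\<in>U. mdist X p x \<le> 1}" and y: "y \<in> {x\<in>U. mdist X p x \<le> 1}"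
      and "to_nat_on C ` near x = to_nat_on C ` near y"
    then have eq: "near x = near y"
      using inj_on_image_eq_iff[OF inj_on_to_nat_on[OF C] near_C near_C] by blast
    have xy: "x \<in> mspace X" "y \<in> mspace X" using x y U by auto
    have "mdist X x y \<le> 2 * (1 / 2) ^ n" for n
    proof -
      obtain z where z: "z \<in> Z n" "mdist X z x \<le> 1 / 2 ^ n" using Z(3) x by blast
      then have "(n, z) \<in> near y" using eq by (auto simp: near_def C_def)
      then have "mdist X z y \<le> 1 / 2 ^ n" by (simp add: near_def)
      moreover have "mdist X x y \<le> mdist X z x + mdist X z y"
        using mdist_triangle[of x X z y] xy z Z(2) U by (auto simp: mdist_commute)
      ultimately show ?thesis using z by (simp add: power_one_over)
    qed
    moreover have "(\<lambda>n. 2 * (1 / 2) ^ n :: real) \<longlonglongrightarrow> 2 * 0"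
      by (intro tendsto_intros LIMSEQ_power_zero) simp
    ultimately have "mdist X x y \<le> 0"
      by (intro LIMSEQ_le_const[of "\<lambda>n. 2 * (1 / 2) ^ n"]) auto
    then show "x = y" using xy mdist_nonneg[of X x y] by (metis mdist_zero order_antisym)
  qed
  then have "{x\<in>U. mdist X p x \<le> 1} \<lesssim> (UNIV :: nat set set)" unfolding lepoll_def by blast
  then show ?thesis using nat_sets_eqpoll_reals lepoll_trans2 by blast
qed

text \<open>
  Call a ball good if it has at most continuum many points. Starting from one point, the good balls
  around all points reached so far are added repeatedly. The set \<open>B\<close> obtained after countably many
  steps has at most continuum many points and is open. It is closed: a good ball around a limit
  point \<open>y\<close> contains the balls of half its radius around the points of \<open>B\<close> near \<open>y\<close>, which are
  therefore good and contain \<open>y\<close>. As geodesics are connected, \<open>B\<close> is the whole space. Restricting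
  the radii \<open>\<rho> k\<close> to the countable family \<open>1 / (k + 1)\<close> keeps each union small, and the family is
  closed under halving.
\<close>

lemma uniformly_locally_doubling_lepoll_reals:
  assumes X: "CAT0 X" "uniformly_locally_doubling N X"
  shows "mspace X \<lesssim> (UNIV :: real set)"
proof (cases "mspace X = {}")
  case True
  then show ?thesis by simp
next
  case False
  then obtain x0 where x0: "x0 \<in> mspace X" by blast
  let ?R = "UNIV :: real set"
  interpret M: Metric_space "mspace X" "mdist X" by (rule Metric_space_mspace_mdist)
  define \<rho> where "\<rho> k = inverse (real (Suc k))" for k
  have \<rho>0: "0 < \<rho> k" for k by (simp add: \<rho>_def)
  define good where "good x = {k. M.mball x (\<rho> k) \<lesssim> ?R}" for x
  have ex_good: "good x \<noteq> {}" if x: "x \<in> mspace X" for x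
  proof -
    obtain U W where UW: "openin M.mtopology W" "x \<in> W" "W \<subseteq> U" "U \<subseteq> mspace X" "doubling N (submetric X U)"
      using X(2) x unfolding uniformly_locally_doubling_def mtopology_of_def by meson
    then obtain r where r: "0 < r" "M.mball x r \<subseteq> W" using M.openin_mtopology by blast
    then obtain k where k: "\<rho> k < r" unfolding \<rho>_def using reals_Archimedean by blast
    have "\<rho> k \<le> 1" by (simp add: \<rho>_def inverse_le_1_iff)
    then have "M.mball x (\<rho> k) \<subseteq> {y\<in>U. mdist X x y \<le> 1}"
      using k r UW(3) by (auto simp: M.mball_def subset_iff)
    then have "M.mball x (\<rho> k) \<lesssim> ?R"
      using doubling_lepoll_reals[OF UW(5,4), of x] UW by (meson lepoll_trans subset_imp_lepoll subsetD)
    then show ?thesis by (auto simp: good_def)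
  qed
  define A where "A = rec_nat {x0} (\<lambda>_ S. \<Union>x\<in>S. \<Union>k\<in>good x. M.mball x (\<rho> k))"
  have A_0: "A 0 = {x0}" and A_Suc: "\<And>n. A (Suc n) = (\<Union>x\<in>A n. \<Union>k\<in>good x. M.mball x (\<rho> k))"
    by (simp_all add: A_def)
  have nat: "(S :: nat set) \<lesssim> ?R" for S
    unfolding lepoll_def by (intro exI[of _ real]) (auto simp: inj_on_def)
  have A_card: "A n \<lesssim> ?R" for n
  proof (induction n)
    case 0
    show ?case unfolding A_0 lepoll_def by (intro exI[of _ "\<lambda>_. 0"]) auto
  next
    case (Suc n)
    then show ?case unfolding A_Suc
      by (intro UNION_lepoll_reals nat) (auto simp: good_def)
  qed
  define B where "B = (\<Union>n. A n)"
  have B_card: "B \<lesssim> ?R" unfolding B_def by (intro UNION_lepoll_reals nat A_card)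
  have B_ball: "M.mball x (\<rho> k) \<subseteq> B" if "x \<in> B" "k \<in> good x" for x k
  proof -
    obtain n where "x \<in> A n" using \<open>x \<in> B\<close> by (auto simp: B_def)
    then have "M.mball x (\<rho> k) \<subseteq> A (Suc n)" using that unfolding A_Suc by blast
    then show ?thesis by (auto simp: B_def)
  qed
  have step: "\<exists>\<epsilon>>0. \<forall>x\<in>mspace X. mdist X y x < \<epsilon> \<longrightarrow> (x \<in> B \<longleftrightarrow> y \<in> B)" if y: "y \<in> mspace X" for y
  proof -
    obtain k where k: "k \<in> good y" using ex_good[OF y] by blast
    \<comment> \<open>Halving \<open>1 / (k + 1)\<close> gives the member of the family with index \<open>2 k + 1\<close>.\<close>
    have half: "\<rho> (2 * k + 1) = \<rho> k / 2" by (simp add: \<rho>_def field_simps)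
    have "y \<in> B" if x: "x \<in> mspace X" "mdist X y x < \<rho> k / 2" "x \<in> B" for x
    proof -
      have "M.mball x (\<rho> k / 2) \<subseteq> M.mball y (\<rho> k)"
      proof
        fix u assume u: "u \<in> M.mball x (\<rho> k / 2)"
        then have "mdist X y u \<le> mdist X y x + mdist X x u"
          using mdist_triangle[of y X x u] x y by (auto simp: M.mball_def)
        then show "u \<in> M.mball y (\<rho> k)" using u x y by (auto simp: M.mball_def)
      qed
      moreover have "M.mball y (\<rho> k) \<lesssim> ?R" using k by (simp add: good_def)
      ultimately have "M.mball x (\<rho> (2 * k + 1)) \<lesssim> ?R"
        unfolding half by (rule lepoll_trans[OF subset_imp_lepoll])
      then have "2 * k + 1 \<in> good x" unfolding good_def by blast
      from B_ball[OF \<open>x \<in> B\<close> this] have "M.mball x (\<rho> k / 2) \<subseteq> B" unfolding half .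
      then show ?thesis using x y by (auto simp: mdist_commute)
    qed
    moreover have "x \<in> B" if "x \<in> mspace X" "mdist X y x < \<rho> k / 2" "y \<in> B" for x
      using B_ball[OF \<open>y \<in> B\<close> k] that y \<rho>0[of k] by (auto simp: M.mball_def)
    ultimately show ?thesis using \<rho>0[of k] by (intro exI[of _ "\<rho> k / 2"]) auto
  qed
  have "mspace X \<subseteq> B"
  proof
    fix y assume y: "y \<in> mspace X"
    obtain c where c: "geodesic_path X c x0 y" using CAT0_geodesic_path[OF X(1) x0 y] .
    let ?I = "{0..mdist X x0 y}"
    have cd: "mdist X (c s) (c t) = \<bar>s - t\<bar>" if "s \<in> ?I" "t \<in> ?I" for s t
      using c that unfolding geodesic_path_def by blast
    have ends: "c 0 = x0" "c (mdist X x0 y) = y" using c unfolding geodesic_path_def by blast+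
    have cX: "c s \<in> mspace X" if "s \<in> ?I" for s using geodesic_path_in[OF c] that by simp
    have "(\<lambda>s. c s \<in> B) constant_on ?I"
    proof (rule locally_constant_imp_constant)
      fix s assume s: "s \<in> ?I"
      obtain \<epsilon> where \<epsilon>: "0 < \<epsilon>" "\<And>x. x \<in> mspace X \<Longrightarrow> mdist X (c s) x < \<epsilon> \<Longrightarrow> (x \<in> B \<longleftrightarrow> c s \<in> B)"
        using step[OF cX[OF s]] by blast
      show "\<exists>T. openin (top_of_set ?I) T \<and> s \<in> T \<and> (\<forall>x\<in>T. (c x \<in> B) = (c s \<in> B))"
      proof (intro exI conjI ballI)
        show "openin (top_of_set ?I) (?I \<inter> ball s \<epsilon>)" by (intro openin_open_Int open_ball)
        show "s \<in> ?I \<inter> ball s \<epsilon>" using s \<epsilon> by simp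
        fix t assume "t \<in> ?I \<inter> ball s \<epsilon>"
        then show "(c t \<in> B) = (c s \<in> B)" using \<epsilon>(2)[OF cX] cd[OF s] by (auto simp: dist_real_def)
      qed
    qed simp
    then obtain b where b: "\<And>s. s \<in> ?I \<Longrightarrow> (c s \<in> B) = b" unfolding constant_on_def by blast
    have "x0 \<in> B" using A_0 unfolding B_def by blast
    then show "y \<in> B" using b[of 0] b[of "mdist X x0 y"] ends by simp
  qed
  then show ?thesis using B_card lepoll_trans subset_imp_lepoll by blast
qed

section \<open>Invariance under isometries\<close>

definition isometry_between :: "('a \<Rightarrow> 'b) \<Rightarrow> 'a metric \<Rightarrow> 'b metric \<Rightarrow> bool" where
  "isometry_between \<phi> X Y \<longleftrightarrow> bij_betw \<phi> (mspace X) (mspace Y) \<and>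
     (\<forall>x\<in>mspace X. \<forall>y\<in>mspace X. mdist Y (\<phi> x) (\<phi> y) = mdist X x y)"

lemma isometry_between_dist:
  "isometry_between \<phi> X Y \<Longrightarrow> x \<in> mspace X \<Longrightarrow> y \<in> mspace X \<Longrightarrow> mdist Y (\<phi> x) (\<phi> y) = mdist X x y"
  by (simp add: isometry_between_def)

lemma isometry_between_in: "isometry_between \<phi> X Y \<Longrightarrow> x \<in> mspace X \<Longrightarrow> \<phi> x \<in> mspace Y"
  unfolding isometry_between_def by (meson bij_betwE)

lemma isometry_between_inverse:
  assumes "isometry_between \<phi> X Y"
  obtains \<psi> where "isometry_between \<psi> Y X" "\<And>x. x \<in> mspace X \<Longrightarrow> \<psi> (\<phi> x) = x" "\<And>y. y \<in> mspace Y \<Longrightarrow> \<phi> (\<psi> y) = y"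
proof
  let ?\<psi> = "inv_into (mspace X) \<phi>"
  have bij: "bij_betw \<phi> (mspace X) (mspace Y)" using assms by (simp add: isometry_between_def)
  show 1: "?\<psi> (\<phi> x) = x" if "x \<in> mspace X" for x using bij that by (simp add: bij_betw_inv_into_left)
  show 2: "\<phi> (?\<psi> y) = y" if "y \<in> mspace Y" for y using bij that by (simp add: bij_betw_inv_into_right)
  have bij': "bij_betw ?\<psi> (mspace Y) (mspace X)" using bij by (rule bij_betw_inv_into)
  then have in': "?\<psi> y \<in> mspace X" if "y \<in> mspace Y" for y using that by (meson bij_betwE)
  show "isometry_between ?\<psi> Y X"
    unfolding isometry_between_def
    using bij' isometry_between_dist[OF assms in' in'] 2 by simp
qed

lemma exists_isometric_copy:
  assumes "inj_on \<phi> (mspace X)"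
  obtains Y where "isometry_between \<phi> X Y"
proof -
  let ?\<psi> = "inv_into (mspace X) \<phi>"
  have \<psi>: "?\<psi> (\<phi> x) = x" if "x \<in> mspace X" for x using assms that by simp
  interpret Y: Metric_space "\<phi> ` mspace X" "\<lambda>a b. mdist X (?\<psi> a) (?\<psi> b)"
    by unfold_locales (auto simp: \<psi> mdist_commute mdist_triangle)
  show thesis
  proof
    show "isometry_between \<phi> X (metric (\<phi> ` mspace X, \<lambda>a b. mdist X (?\<psi> a) (?\<psi> b)))"
      unfolding isometry_between_def using assms by (simp add: \<psi> bij_betw_imageI)
  qed
qed

lemma mcomplete_of_isometry:
  assumes iso: "isometry_between \<phi> X Y" and X: "mcomplete_of X"
  shows "mcomplete_of Y"
proof -
  interpret X: Metric_space "mspace X" "mdist X" by (rule Metric_space_mspace_mdist)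
  interpret Y: Metric_space "mspace Y" "mdist Y" by (rule Metric_space_mspace_mdist)
  obtain \<psi> where \<psi>: "isometry_between \<psi> Y X" "\<And>x. x \<in> mspace X \<Longrightarrow> \<psi> (\<phi> x) = x"
    using isometry_between_inverse[OF iso] by metis
  show ?thesis
    unfolding mcomplete_of_def Y.mcomplete_def
  proof (intro allI impI)
    fix \<sigma> assume \<sigma>: "Y.MCauchy \<sigma>"
    then have \<sigma>Y: "\<sigma> n \<in> mspace Y" for n by (auto simp: Y.MCauchy_def)
    have "X.MCauchy (\<lambda>n. \<psi> (\<sigma> n))"
      using \<sigma> unfolding X.MCauchy_def Y.MCauchy_def
      by (auto simp: isometry_between_dist[OF \<psi>(1) \<sigma>Y \<sigma>Y] isometry_between_in[OF \<psi>(1) \<sigma>Y])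
    then obtain l where "limitin X.mtopology (\<lambda>n. \<psi> (\<sigma> n)) l sequentially"
      using X unfolding mcomplete_of_def X.mcomplete_def by blast
    then have l: "l \<in> mspace X" "(\<lambda>n. mdist X (\<psi> (\<sigma> n)) l) \<longlonglongrightarrow> 0"
      unfolding X.limitin_metric_dist_null by auto
    have "mdist Y (\<sigma> n) (\<phi> l) = mdist X (\<psi> (\<sigma> n)) l" for n
      using isometry_between_dist[OF \<psi>(1) \<sigma>Y isometry_between_in[OF iso l(1)]] \<psi>(2)[OF l(1)] by simp
    then have "limitin Y.mtopology \<sigma> (\<phi> l) sequentially"
      unfolding Y.limitin_metric_dist_null using l \<sigma>Y isometry_between_in[OF iso l(1)] by simp
    then show "\<exists>x. limitin Y.mtopology \<sigma> x sequentially" by blast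
  qed
qed

lemma geodesic_path_isometry:
  assumes iso: "isometry_between \<phi> X Y" and c: "geodesic_path X c x y"
    and x: "x \<in> mspace X" and y: "y \<in> mspace X"
  shows "geodesic_path Y (\<lambda>s. \<phi> (c s)) (\<phi> x) (\<phi> y)"
proof -
  have cX: "c s \<in> mspace X" if "s \<in> {0..mdist X x y}" for s using geodesic_path_in[OF c] that by simp
  show ?thesis
    using c cX unfolding geodesic_path_def isometry_between_dist[OF iso x y]
    by (auto simp: isometry_between_dist[OF iso] isometry_between_in[OF iso])
qed

lemma geodesic_segment_isometry:
  assumes iso: "isometry_between \<phi> X Y" and S: "geodesic_segment X x y S"
    and x: "x \<in> mspace X" and y: "y \<in> mspace X"
  shows "geodesic_segment Y (\<phi> x) (\<phi> y) (\<phi> ` S)"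
proof -
  obtain c where c: "geodesic_path X c x y" "S = c ` {0..mdist X x y}"
    using S unfolding geodesic_segment_def by blast
  show ?thesis unfolding geodesic_segment_def
    by (intro exI[of _ "\<lambda>s. \<phi> (c s)"] conjI geodesic_path_isometry[OF iso c(1) x y])
      (simp add: c(2) image_image isometry_between_dist[OF iso x y])
qed

lemma geodesic_segment_subset: "geodesic_segment X x y S \<Longrightarrow> S \<subseteq> mspace X"
  unfolding geodesic_segment_def using geodesic_path_in by fastforce

lemma comparison_point_isometry:
  assumes iso: "isometry_between \<phi> X Y" and p: "comparison_point X x S x' y' p p'"
    and x: "x \<in> mspace X" and S: "S \<subseteq> mspace X"
  shows "comparison_point Y (\<phi> x) (\<phi> ` S) x' y' (\<phi> p) p'"
proof -
  have "p \<in> mspace X" using p S by (auto simp: comparison_point_def)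
  then show ?thesis using p by (auto simp: comparison_point_def isometry_between_dist[OF iso x])
qed

lemma CAT0_isometry:
  assumes iso: "isometry_between \<phi> X Y" and X: "CAT0 X"
  shows "CAT0 Y"
proof -
  obtain \<psi> where \<psi>: "isometry_between \<psi> Y X" "\<And>y. y \<in> mspace Y \<Longrightarrow> \<phi> (\<psi> y) = y"
    using isometry_between_inverse[OF iso] by metis
  have \<psi>X: "\<psi> y \<in> mspace X" if "y \<in> mspace Y" for y using isometry_between_in[OF \<psi>(1) that] .
  have \<psi>d: "mdist X (\<psi> x) (\<psi> y) = mdist Y x y" if "x \<in> mspace Y" "y \<in> mspace Y" for x y
    using isometry_between_dist[OF \<psi>(1) that] .
  have "geodesic_space Y"
    unfolding geodesic_space_def
  proof (intro ballI)
    fix x y assume xy: "x \<in> mspace Y" "y \<in> mspace Y"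
    then obtain S where "geodesic_segment X (\<psi> x) (\<psi> y) S"
      using X \<psi>X unfolding CAT0_def geodesic_space_def by blast
    from geodesic_segment_isometry[OF iso this] show "\<exists>S. geodesic_segment Y x y S"
      using xy \<psi>X \<psi>(2) by auto
  qed
  moreover have "mdist Y p q \<le> dist p' q'"
    if xyz: "x \<in> mspace Y" "y \<in> mspace Y" "z \<in> mspace Y"
      and seg: "geodesic_segment Y x y A" "geodesic_segment Y y z B" "geodesic_segment Y z x C"
      and d: "dist x' y' = mdist Y x y" "dist y' z' = mdist Y y z" "dist z' x' = mdist Y z x"
      and p: "comparison_point Y x A x' y' p p' \<or> comparison_point Y y B y' z' p p' \<or> comparison_point Y z C z' x' p p'"
      and q: "comparison_point Y x A x' y' q q' \<or> comparison_point Y y B y' z' q q' \<or> comparison_point Y z C z' x' q q'"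
    for x y z A B C and x' y' z' :: "real^2" and p q p' q'
  proof -
    have sub: "A \<subseteq> mspace Y" "B \<subseteq> mspace Y" "C \<subseteq> mspace Y" using seg[THEN geodesic_segment_subset] .
    have pq: "p \<in> mspace Y" "q \<in> mspace Y" using p q sub by (auto simp: comparison_point_def)
    have comp: "comparison_point X (\<psi> x) (\<psi> ` A) x' y' (\<psi> r) r' \<or> comparison_point X (\<psi> y) (\<psi> ` B) y' z' (\<psi> r) r' \<or>
        comparison_point X (\<psi> z) (\<psi> ` C) z' x' (\<psi> r) r'"
      if "comparison_point Y x A x' y' r r' \<or> comparison_point Y y B y' z' r r' \<or> comparison_point Y z C z' x' r r'" for r r'
      using that comparison_point_isometry[OF \<psi>(1)] xyz sub by blast
    have "mdist X (\<psi> p) (\<psi> q) \<le> dist p' q'"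
      by (rule X[unfolded CAT0_def Let_def, THEN conjunct2, rule_format, OF \<psi>X[OF xyz(1)] \<psi>X[OF xyz(2)] \<psi>X[OF xyz(3)],
          of "\<psi> ` A" "\<psi> ` B" "\<psi> ` C" x' y' z' "\<psi> p" p' "\<psi> q" q'])
        (intro conjI geodesic_segment_isometry[OF \<psi>(1)] seg xyz comp[OF p] comp[OF q]; simp add: d \<psi>d xyz)+
    then show ?thesis using \<psi>d pq by simp
  qed
  ultimately show ?thesis unfolding CAT0_def Let_def by (intro conjI ballI allI impI) blast+
qed

lemma doubling_isometry:
  assumes iso: "isometry_between \<phi> X Y" and X: "doubling N X"
  shows "doubling N Y"
  unfolding doubling_def
proof (intro ballI allI impI)
  fix y and r :: real assume y: "y \<in> mspace Y" and r: "0 < r"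
  obtain \<psi> where \<psi>: "isometry_between \<psi> Y X" "\<And>y. y \<in> mspace Y \<Longrightarrow> \<phi> (\<psi> y) = y"
    using isometry_between_inverse[OF iso] by metis
  have \<psi>X: "\<psi> y \<in> mspace X" if "y \<in> mspace Y" for y using isometry_between_in[OF \<psi>(1) that] .
  obtain Z where Z: "finite Z" "real (card Z) \<le> N" "Z \<subseteq> mspace X"
    "mcball_of X (\<psi> y) r \<subseteq> (\<Union>z\<in>Z. mcball_of X z (r / 2))"
    using X \<psi>X[OF y] r unfolding doubling_def by meson
  have "mcball_of Y y r \<subseteq> (\<Union>z\<in>\<phi> ` Z. mcball_of Y z (r / 2))"
  proof
    fix u assume u: "u \<in> mcball_of Y y r"
    then have uY: "u \<in> mspace Y" by simp
    have "\<psi> u \<in> mcball_of X (\<psi> y) r"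
      using u y \<psi>X isometry_between_dist[OF \<psi>(1) y uY] by simp
    then obtain z where z: "z \<in> Z" "\<psi> u \<in> mcball_of X z (r / 2)" using Z(4) by blast
    then have "mdist Y (\<phi> z) (\<phi> (\<psi> u)) \<le> r / 2"
      using isometry_between_dist[OF iso, of z "\<psi> u"] by simp
    then have "u \<in> mcball_of Y (\<phi> z) (r / 2)"
      using z uY \<psi>(2)[OF uY] isometry_between_in[OF iso, of z] by simp
    then show "u \<in> (\<Union>z\<in>\<phi> ` Z. mcball_of Y z (r / 2))" using z by blast
  qed
  moreover have "real (card (\<phi> ` Z)) \<le> N" using card_image_le[OF Z(1), of \<phi>] Z(2) by linarith
  moreover have "\<phi> ` Z \<subseteq> mspace Y" using Z(3) isometry_between_in[OF iso] by blast
  ultimately show "\<exists>Z. finite Z \<and> real (card Z) \<le> N \<and> Z \<subseteq> mspace Y \<and> mcball_of Y y r \<subseteq> (\<Union>z\<in>Z. mcball_of Y z (r / 2))"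
    using Z(1) by blast
qed

lemma isometry_between_submetric:
  assumes iso: "isometry_between \<phi> X Y" and U: "U \<subseteq> mspace X"
  shows "isometry_between \<phi> (submetric X U) (submetric Y (\<phi> ` U))"
proof -
  have "mspace (submetric X U) = U" "mspace (submetric Y (\<phi> ` U)) = \<phi> ` U"
    using U isometry_between_in[OF iso] by auto
  moreover have "inj_on \<phi> U" using iso U unfolding isometry_between_def bij_betw_def by (meson inj_on_subset)
  ultimately show ?thesis
    unfolding isometry_between_def using isometry_between_dist[OF iso] U by (simp add: bij_betw_imageI subset_iff)
qed

lemma openin_isometry:
  assumes iso: "isometry_between \<phi> X Y" and W: "openin (mtopology_of X) W"
  shows "openin (mtopology_of Y) (\<phi> ` W)"
proof -
  interpret X: Metric_space "mspace X" "mdist X" by (rule Metric_space_mspace_mdist)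
  interpret Y: Metric_space "mspace Y" "mdist Y" by (rule Metric_space_mspace_mdist)
  obtain \<psi> where \<psi>: "isometry_between \<psi> Y X" "\<And>x. x \<in> mspace X \<Longrightarrow> \<psi> (\<phi> x) = x" "\<And>y. y \<in> mspace Y \<Longrightarrow> \<phi> (\<psi> y) = y"
    using isometry_between_inverse[OF iso] by metis
  have WX: "W \<subseteq> mspace X" and ball: "\<And>x. x \<in> W \<Longrightarrow> \<exists>r>0. X.mball x r \<subseteq> W"
    using W unfolding mtopology_of_def X.openin_mtopology by auto
  have "\<exists>r>0. Y.mball (\<phi> x) r \<subseteq> \<phi> ` W" if x: "x \<in> W" for x
  proof -
    obtain r where r: "0 < r" "X.mball x r \<subseteq> W" using ball[OF x] by blast
    have "Y.mball (\<phi> x) r \<subseteq> \<phi> ` W"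
    proof
      fix y assume y: "y \<in> Y.mball (\<phi> x) r"
      then have yY: "y \<in> mspace Y" and d: "mdist Y (\<phi> x) y < r" by auto
      have xX: "x \<in> mspace X" using x WX by blast
      have "mdist X x (\<psi> y) = mdist Y (\<phi> x) y"
        using isometry_between_dist[OF \<psi>(1) isometry_between_in[OF iso xX] yY] \<psi>(2)[OF xX] by simp
      then have "\<psi> y \<in> X.mball x r" using d xX isometry_between_in[OF \<psi>(1) yY] by simp
      then show "y \<in> \<phi> ` W" using r(2) \<psi>(3)[OF yY] by (metis imageI subsetD)
    qed
    then show ?thesis using r by blast
  qed
  moreover have "\<phi> ` W \<subseteq> mspace Y" using WX isometry_between_in[OF iso] by blast
  ultimately show ?thesis unfolding mtopology_of_def Y.openin_mtopology by blast
qed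

lemma uniformly_locally_doubling_isometry:
  assumes iso: "isometry_between \<phi> X Y" and X: "uniformly_locally_doubling N X"
  shows "uniformly_locally_doubling N Y"
  unfolding uniformly_locally_doubling_def
proof
  fix y assume y: "y \<in> mspace Y"
  then obtain x where x: "x \<in> mspace X" "y = \<phi> x"
    using iso unfolding isometry_between_def bij_betw_def by blast
  then obtain U W where UW: "openin (mtopology_of X) W" "x \<in> W" "W \<subseteq> U" "U \<subseteq> mspace X" "doubling N (submetric X U)"
    using X unfolding uniformly_locally_doubling_def by meson
  have "doubling N (submetric Y (\<phi> ` U))"
    using doubling_isometry[OF isometry_between_submetric[OF iso UW(4)] UW(5)] .
  moreover have "\<phi> ` U \<subseteq> mspace Y" using UW(4) isometry_between_in[OF iso] by blast
  ultimately show "\<exists>U W. openin (mtopology_of Y) W \<and> y \<in> W \<and> W \<subseteq> U \<and> U \<subseteq> mspace Y \<and> doubling N (submetric Y U)"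
    using openin_isometry[OF iso UW(1)] UW(2,3) x(2) by (meson image_eqI image_mono)
qed

lemma gromov_quotient_isometry:
  assumes iso: "isometry_between \<phi> X Y" and f: "f \<in> pverts G \<rightarrow> mspace X"
    and nonconst: "\<exists>u\<in>pverts G. \<exists>v\<in>pverts G. f u \<noteq> f v"
  shows "\<exists>g. gromov_quotient G X f = gromov_quotient G Y g \<and> g \<in> pverts G \<rightarrow> mspace Y \<and>
    (\<exists>u\<in>pverts G. \<exists>v\<in>pverts G. g u \<noteq> g v)"
proof (intro exI[of _ "\<lambda>v. \<phi> (f v)"] conjI)
  have fX: "f v \<in> mspace X" if "v \<in> pverts G" for v using f that by auto
  show "gromov_quotient G X f = gromov_quotient G Y (\<lambda>v. \<phi> (f v))"
    unfolding gromov_quotient_def by (simp add: isometry_between_dist[OF iso fX fX] cong: sum.cong)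
  show "(\<lambda>v. \<phi> (f v)) \<in> pverts G \<rightarrow> mspace Y" using fX isometry_between_in[OF iso] by auto
  have "inj_on \<phi> (mspace X)" using iso by (simp add: isometry_between_def bij_betw_def)
  then show "\<exists>u\<in>pverts G. \<exists>v\<in>pverts G. \<phi> (f u) \<noteq> \<phi> (f v)" using nonconst fX by (metis inj_onD)
qed

lemma gromov_gap_isometry:
  assumes iso: "isometry_between \<phi> X Y"
  shows "gromov_gap G X = gromov_gap G Y"
proof -
  obtain \<psi> where \<psi>: "isometry_between \<psi> Y X" using isometry_between_inverse[OF iso] by metis
  show ?thesis
    unfolding gromov_gap_def
  proof (intro arg_cong[of _ _ Inf] set_eqI iffI; clarify)
    fix f u v assume "f \<in> pverts G \<rightarrow> mspace X" "u \<in> pverts G" "v \<in> pverts G" "f u \<noteq> f v"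
    then show "\<exists>g. gromov_quotient G X f = gromov_quotient G Y g \<and> g \<in> pverts G \<rightarrow> mspace Y \<and>
        (\<exists>u\<in>pverts G. \<exists>v\<in>pverts G. g u \<noteq> g v)"
      using gromov_quotient_isometry[OF iso] by blast
  next
    fix f u v assume "f \<in> pverts G \<rightarrow> mspace Y" "u \<in> pverts G" "v \<in> pverts G" "f u \<noteq> f v"
    then show "\<exists>g. gromov_quotient G Y f = gromov_quotient G X g \<and> g \<in> pverts G \<rightarrow> mspace X \<and>
        (\<exists>u\<in>pverts G. \<exists>v\<in>pverts G. g u \<noteq> g v)"
      using gromov_quotient_isometry[OF \<psi>] by blast
  qed
qed

section \<open>Invariance under relabelling of vertices\<close>

definition relabel :: "('v \<Rightarrow> 'w) \<Rightarrow> 'v pair_pre_digraph \<Rightarrow> 'w pair_pre_digraph" where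
  "relabel h G = \<lparr>pverts = h ` pverts G, parcs = map_prod h h ` parcs G\<rparr>"

context
  fixes h :: "'v \<Rightarrow> 'w" and G :: "'v pair_pre_digraph"
  assumes G: "std_graph G" and h: "inj_on h (pverts G)"
begin

lemma edge_weight_relabel:
  assumes u: "u \<in> pverts G" and v: "v \<in> pverts G"
  shows "edge_weight (relabel h G) (h u) (h v) = edge_weight G u v"
proof -
  have "(h u, h v) \<in> map_prod h h ` parcs G \<longleftrightarrow> (u, v) \<in> parcs G"
  proof
    assume "(h u, h v) \<in> map_prod h h ` parcs G"
    then obtain a b where ab: "(a, b) \<in> parcs G" "h u = h a" "h v = h b" by auto
    then have "a \<in> pverts G" "b \<in> pverts G" using G by (auto simp: std_graph_iff)
    then have "u = a" "v = b" using ab h u v by (meson inj_onD)+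
    then show "(u, v) \<in> parcs G" using ab by simp
  qed (simp add: rev_image_eqI)
  then show ?thesis by (simp add: edge_weight_def relabel_def)
qed

lemma sum_relabel: "(\<Sum>v\<in>pverts (relabel h G). k v) = (\<Sum>v\<in>pverts G. k (h v))"
  using h by (simp add: relabel_def sum.reindex)

lemma vertex_weight_relabel: "u \<in> pverts G \<Longrightarrow> vertex_weight (relabel h G) (h u) = vertex_weight G u"
  unfolding vertex_weight_def sum_relabel by (intro sum.cong refl edge_weight_relabel)

lemma total_weight_relabel: "total_weight (relabel h G) = total_weight G"
  unfolding total_weight_def sum_relabel by (intro sum.cong refl vertex_weight_relabel)

lemma laplacian_relabel:
  assumes v: "v \<in> pverts G"
  shows "laplacian (relabel h G) f (h v) = laplacian G (\<lambda>u. f (h u)) v"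
  unfolding laplacian_def sum_relabel
  by (simp add: edge_weight_relabel[OF v] vertex_weight_relabel[OF v] cong: sum.cong)

lemma linear_gap_relabel: "linear_gap (relabel h G) = linear_gap G"
proof -
  have "laplacian_eigenvalue (relabel h G) \<mu> \<longleftrightarrow> laplacian_eigenvalue G \<mu>" for \<mu>
  proof
    assume "laplacian_eigenvalue (relabel h G) \<mu>"
    then obtain f where f: "\<exists>v\<in>pverts (relabel h G). f v \<noteq> 0"
      "\<And>v. v \<in> pverts (relabel h G) \<Longrightarrow> laplacian (relabel h G) f v = \<mu> * f v"
      unfolding laplacian_eigenvalue_def by blast
    have "\<exists>v\<in>pverts G. f (h v) \<noteq> 0" using f(1) by (simp add: relabel_def)
    moreover have "laplacian G (\<lambda>v. f (h v)) v = \<mu> * f (h v)" if "v \<in> pverts G" for v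
      using f(2)[of "h v"] laplacian_relabel[OF that] that by (simp add: relabel_def)
    ultimately show "laplacian_eigenvalue G \<mu>"
      unfolding laplacian_eigenvalue_def by (intro exI[of _ "\<lambda>v. f (h v)"]) simp
  next
    assume "laplacian_eigenvalue G \<mu>"
    then obtain f where f: "\<exists>v\<in>pverts G. f v \<noteq> 0" "\<And>v. v \<in> pverts G \<Longrightarrow> laplacian G f v = \<mu> * f v"
      unfolding laplacian_eigenvalue_def by blast
    define g where "g w = f (inv_into (pverts G) h w)" for w
    have g: "g (h v) = f v" if "v \<in> pverts G" for v using h that by (simp add: g_def)
    have "laplacian (relabel h G) g (h v) = \<mu> * g (h v)" if v: "v \<in> pverts G" for v
    proof -
      have "laplacian G (\<lambda>u. g (h u)) v = laplacian G f v"
        unfolding laplacian_def using g v by (simp cong: sum.cong)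
      then show ?thesis using laplacian_relabel[OF v] f(2)[OF v] g[OF v] by simp
    qed
    moreover have "\<exists>v\<in>pverts G. g (h v) \<noteq> 0" using f(1) g by simp
    ultimately show "laplacian_eigenvalue (relabel h G) \<mu>"
      unfolding laplacian_eigenvalue_def by (intro exI[of _ g]) (simp add: relabel_def)
  qed
  then show ?thesis unfolding linear_gap_def by simp
qed

lemma gromov_quotient_relabel: "gromov_quotient (relabel h G) X f = gromov_quotient G X (\<lambda>v. f (h v))"
  unfolding gromov_quotient_def sum_relabel total_weight_relabel
  by (simp add: edge_weight_relabel vertex_weight_relabel cong: sum.cong)

lemma gromov_gap_relabel: "gromov_gap (relabel h G) X = gromov_gap G X"
proof -
  have "{gromov_quotient (relabel h G) X f | f. f \<in> pverts (relabel h G) \<rightarrow> mspace X \<and>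
       (\<exists>u\<in>pverts (relabel h G). \<exists>v\<in>pverts (relabel h G). f u \<noteq> f v)} =
     {gromov_quotient G X f | f. f \<in> pverts G \<rightarrow> mspace X \<and> (\<exists>u\<in>pverts G. \<exists>v\<in>pverts G. f u \<noteq> f v)}"
    (is "?L = ?R")
  proof
    show "?L \<subseteq> ?R"
    proof clarify
      fix f u v assume f: "f \<in> pverts (relabel h G) \<rightarrow> mspace X"
        and uv: "u \<in> pverts (relabel h G)" "v \<in> pverts (relabel h G)" "f u \<noteq> f v"
      have "(\<lambda>v. f (h v)) \<in> pverts G \<rightarrow> mspace X" using f by (auto simp: relabel_def)
      moreover have "\<exists>u\<in>pverts G. \<exists>v\<in>pverts G. f (h u) \<noteq> f (h v)" using uv by (auto simp: relabel_def)
      ultimately show "\<exists>g. gromov_quotient (relabel h G) X f = gromov_quotient G X g \<and> g \<in> pverts G \<rightarrow> mspace X \<and>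
          (\<exists>u\<in>pverts G. \<exists>v\<in>pverts G. g u \<noteq> g v)"
        using gromov_quotient_relabel by blast
    qed
    show "?R \<subseteq> ?L"
    proof clarify
      fix f u v assume f: "f \<in> pverts G \<rightarrow> mspace X" and uv: "u \<in> pverts G" "v \<in> pverts G" "f u \<noteq> f v"
      define g where "g w = f (inv_into (pverts G) h w)" for w
      have g: "g (h v) = f v" if "v \<in> pverts G" for v using h that by (simp add: g_def)
      have "gromov_quotient G X (\<lambda>v. g (h v)) = gromov_quotient G X f"
        unfolding gromov_quotient_def by (simp add: g cong: sum.cong)
      then have "gromov_quotient G X f = gromov_quotient (relabel h G) X g"
        by (simp add: gromov_quotient_relabel)
      moreover have "g \<in> pverts (relabel h G) \<rightarrow> mspace X" using f g by (auto simp: relabel_def)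
      moreover have "\<exists>u\<in>pverts (relabel h G). \<exists>v\<in>pverts (relabel h G). g u \<noteq> g v"
        using uv g by (auto simp: relabel_def)
      ultimately show "\<exists>g. gromov_quotient G X f = gromov_quotient (relabel h G) X g \<and> g \<in> pverts (relabel h G) \<rightarrow> mspace X \<and>
          (\<exists>u\<in>pverts (relabel h G). \<exists>v\<in>pverts (relabel h G). g u \<noteq> g v)"
        by blast
    qed
  qed
  then show ?thesis unfolding gromov_gap_def by simp
qed

lemma std_graph_relabel: "std_graph (relabel h G)"
proof -
  have wf: "parcs G \<subseteq> pverts G \<times> pverts G" and sym: "sym (parcs G)" and irrefl: "irrefl (parcs G)"
    using G by (auto simp: std_graph_iff)
  have "sym (map_prod h h ` parcs G)" using sym by (auto simp: sym_def)
  moreover have "irrefl (map_prod h h ` parcs G)"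
  proof (rule irreflI)
    fix a show "(a, a) \<notin> map_prod h h ` parcs G"
    proof
      assume "(a, a) \<in> map_prod h h ` parcs G"
      then obtain u v where "(u, v) \<in> parcs G" "h u = h v" by auto
      then have "(u, u) \<in> parcs G" using wf h by (metis inj_onD mem_Sigma_iff subsetD)
      then show False using irrefl by (simp add: irrefl_def)
    qed
  qed
  moreover have "(h u, h v) \<in> (map_prod h h ` parcs G)\<^sup>*" if "u \<in> pverts G" "v \<in> pverts G" for u v
  proof -
    have "(u, v) \<in> (parcs G)\<^sup>*" using G that by (simp add: std_graph_iff)
    then show ?thesis
    proof (induct rule: rtrancl_induct)
      case (step x y)
      then show ?case by (metis map_prod_imageI rtrancl.rtrancl_into_rtrancl)
    qed simp
  qed
  ultimately show ?thesis
    using G wf card_image[OF h] unfolding std_graph_iff relabel_def by auto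
qed

end

section \<open>One constant for all carrier types\<close>

text \<open>
  Both gaps are invariant under isometries and relabellings, so the given space and graph may be
  replaced by copies with points in \<open>real\<close> and vertices in \<open>nat\<close>.
\<close>

lemma gap_constant_transfer:
  assumes const: "gap_constant TYPE(nat) TYPE(real) N C"
  shows "gap_constant TYPE('v) TYPE('a) N C"
  unfolding gap_constant_def
proof (intro allI impI, elim conjE)
  fix X :: "'a metric" and G :: "'v pair_pre_digraph"
  assume two: "\<exists>x\<in>mspace X. \<exists>y\<in>mspace X. x \<noteq> y" and X: "mcomplete_of X" "CAT0 X" "uniformly_locally_doubling N X"
    and G: "std_graph G"
  have "finite (pverts G)" using G by (simp add: std_graph_iff)
  then obtain h :: "'v \<Rightarrow> nat" where h: "inj_on h (pverts G)" using finite_imp_inj_to_nat_seg by metis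
  obtain \<phi> :: "'a \<Rightarrow> real" where "inj_on \<phi> (mspace X)"
    using uniformly_locally_doubling_lepoll_reals[OF X(2,3)] unfolding lepoll_def by blast
  then obtain Y where iso: "isometry_between \<phi> X Y" by (rule exists_isometric_copy)
  have "\<exists>x\<in>mspace Y. \<exists>y\<in>mspace Y. x \<noteq> y"
    using two iso unfolding isometry_between_def bij_betw_def by (metis imageI inj_onD)
  then have "C * linear_gap (relabel h G) \<le> gromov_gap (relabel h G) Y"
    using const mcomplete_of_isometry[OF iso X(1)] CAT0_isometry[OF iso X(2)]
      uniformly_locally_doubling_isometry[OF iso X(3)] std_graph_relabel[OF G h]
    unfolding gap_constant_def by blast
  then show "C * linear_gap G \<le> gromov_gap G X"
    by (simp add: linear_gap_relabel[OF G h] gromov_gap_relabel[OF G h] gromov_gap_isometry[OF iso])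
qed

theorem corollary1p8:
  fixes N :: real
  assumes "1 \<le> N"
  shows "(\<exists>C>0. gap_constant TYPE(nat) TYPE(real) N C) \<and>
         (\<forall>C>0. gap_constant TYPE(nat) TYPE(real) N C \<longrightarrow> gap_constant TYPE('v) TYPE('a) N C)"
proof (intro conjI allI impI)
  have "0 < 1 / (2 * (3 + 8 * N\<^sup>2))" by (simp add: add_pos_nonneg)
  then show "\<exists>C>0. gap_constant TYPE(nat) TYPE(real) N C" using gap_constant_exists[OF assms] by blast
qed (rule gap_constant_transfer)

end
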